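(* Let $\{T_i\}_{i\in I}$ be a family of rings with $I$ infinite, and let $T=\prod_{i\in I}T_i$. (1) If each $T_i$ is integral over its center, then $T$ has a maximal subring. (2) If $T$ is integral over its center, then $T$ has a maximal subring.
   Context: All rings are associative with identity $1\neq0$; subrings contain the identity. A maximal subring of $T$ is a proper subring with no subring strictly between it and $T$. A ring $S$ is integral over its center $C(S)$ if every element of $S$ is a root of a monic polynomial with coefficients in $C(S)$. *)

theory Defs
  imports "HOL-Algebra.Algebra"
begin

definition product_ring :: "'i set \<Rightarrow> ('i \<Rightarrow> ('a, 'b) ring_scheme) \<Rightarrow> ('i \<Rightarrow> 'a) ring" where
  "product_ring I R =
    \<lparr>carrier = (\<Pi>\<^sub>E i\<in>I. carrier (R i)),
     Group.monoid.mult = (\<lambda>x y. \<lambda>i\<in>I. x i \<otimes>\<^bsub>R i\<^esub> y i),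
     one = (\<lambda>i\<in>I. \<one>\<^bsub>R i\<^esub>),
     Ring.ring.zero = (\<lambda>i\<in>I. \<zero>\<^bsub>R i\<^esub>),
     Ring.ring.add = (\<lambda>x y. \<lambda>i\<in>I. x i \<oplus>\<^bsub>R i\<^esub> y i)\<rparr>"

definition ring_center :: "('a, 'b) ring_scheme \<Rightarrow> 'a set" where
  "ring_center R = {z \<in> carrier R. \<forall>x \<in> carrier R. z \<otimes>\<^bsub>R\<^esub> x = x \<otimes>\<^bsub>R\<^esub> z}"

definition integral_over_center :: "('a, 'b) ring_scheme \<Rightarrow> bool" where
  "integral_over_center R \<longleftrightarrow>
    (\<forall>x \<in> carrier R. \<exists>(n::nat) c. c \<in> {..<n} \<rightarrow> ring_center R \<and>
       x [^]\<^bsub>R\<^esub> n \<oplus>\<^bsub>R\<^esub> (\<Oplus>\<^bsub>R\<^esub> j\<in>{..<n}. c j \<otimes>\<^bsub>R\<^esub> x [^]\<^bsub>R\<^esub> j) = \<zero>\<^bsub>R\<^esub>)"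

definition maximal_subring :: "'a set \<Rightarrow> ('a, 'b) ring_scheme \<Rightarrow> bool" where
  "maximal_subring S R \<longleftrightarrow> subring S R \<and> S \<noteq> carrier R \<and>
     (\<forall>S'. subring S' R \<and> S \<subseteq> S' \<longrightarrow> S' = S \<or> S' = carrier R)"

definition has_maximal_subring :: "('a, 'b) ring_scheme \<Rightarrow> bool" where
  "has_maximal_subring R \<longleftrightarrow> (\<exists>S. maximal_subring S R)"

end

theory Submission
  imports Defs
begin

text \<open>A ring that is finitely generated over a proper subring has a maximal subring, and maximal
  subrings pull back along surjective homomorphisms. Integrality over the center passes to quotients,
  so each factor may be replaced by a simple quotient. A noncommutative simple ring that is integral
  over its center is finitely generated over the centralizer of any noncentral element. Otherwise it
  suffices to treat a countable product of fields. If the fields do not admit elements avoiding the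
  roots of more and more integer polynomials, infinitely many of them are finite of bounded size, so
  two of them have the same characteristic; their product is finite and differs from its
  prime subring. In the remaining case some field quotient of the product contains an element \<open>x\<close>
  that is transcendental over the prime subring. Choose \<open>L\<close> maximal among the subrings over which
  \<open>x\<close> is transcendental and \<open>M \<supseteq> L[x]\<close> maximal among the subrings without \<open>1/x\<close>: then \<open>M\<close> is
  integrally closed with \<open>x\<close> in its Jacobson radical, and \<open>M\<close> and \<open>1/x\<close> generate the field because
  every element is algebraic over \<open>L[x]\<close>.\<close>

section \<open>Existence of maximal subrings\<close>

text \<open>A finite product of prime fields of distinct positive characteristics is generated by 1
  and has no proper subring at all, so the infinitude of \<open>I\<close> must enter. It does so
  twice: as a pigeonhole for equal characteristics, and as room for a coordinatewise choice that
  eventually defeats every integer polynomial. In the noncommutative case, let \<open>a\<close> have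
  least degree n over the center. Simplicity then gives an operator sending s to a finite sum of u s
  v that kills the lower powers of \<open>a\<close> and takes the value 1 at a^(n-1); its factors v
  are the generators over the centralizer. For a field, maximality of L has two effects: L is itself
  a field, and every element is algebraic over L[x]. Since x lies in the Jacobson radical of M,
  polynomials in x over L with nonzero constant term become units of M, so every nonzero element of
  L[x] divides a power of x in M. An algebraic relation can thus be given a power of x as leading
  coefficient, and integral closedness then bounds the denominators by powers of x.\<close>

lemma (in ring) subring_Union_chain:
  assumes "C \<noteq> {}" "subset.chain {B. subring B R \<and> Q B} C"
  shows "subring (\<Union>C) R"
proof -
  have sub: "subring B R" if "B \<in> C" for B
    using assms(2) that by (auto simp: pred_on.chain_def)
  have two: "\<exists>B\<in>C. x \<in> B \<and> y \<in> B" if "x \<in> \<Union>C" "y \<in> \<Union>C" for x y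
    using finite_subset_Union_chain[OF _ _ assms, of "{x, y}"] that by auto
  show ?thesis
  proof (rule subringI)
    show "\<Union>C \<subseteq> carrier R"
      using sub subringE(1) by blast
    show "\<one> \<in> \<Union>C"
      using assms(1) sub subringE(3) by blast
  next
    fix h assume "h \<in> \<Union>C"
    then show "\<ominus> h \<in> \<Union>C"
      using subringE(5)[OF sub] by (metis UnionE UnionI)
  next
    fix x y assume "x \<in> \<Union>C" "y \<in> \<Union>C"
    then obtain B where "B \<in> C" "x \<in> B" "y \<in> B"
      using two by blast
    then show "x \<otimes> y \<in> \<Union>C" "x \<oplus> y \<in> \<Union>C"
      using subringE(6,7)[OF sub] by (metis UnionI)+
  qed
qed

text \<open>Zorn's lemma above \<open>A\<close>. The properties \<open>P\<close> used later are
  missing part of a finite set, keeping the powers of an element independent, and omitting an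
  inverse; each survives unions of chains because a failure involves only finitely many
  elements.\<close>

lemma (in ring) exists_maximal_subring_with:
  assumes "subring A R" "P A"
    and chain: "\<And>C. C \<noteq> {} \<Longrightarrow> subset.chain {B. subring B R \<and> A \<subseteq> B \<and> P B} C \<Longrightarrow> P (\<Union>C)"
  shows "\<exists>M. subring M R \<and> A \<subseteq> M \<and> P M \<and> (\<forall>B. subring B R \<longrightarrow> M \<subseteq> B \<longrightarrow> P B \<longrightarrow> B = M)"
proof -
  let ?F = "{B. subring B R \<and> A \<subseteq> B \<and> P B}"
  have "\<exists>M\<in>?F. \<forall>Y\<in>?F. M \<subseteq> Y \<longrightarrow> Y = M"
  proof (rule subset_Zorn_nonempty)
    fix C assume C: "C \<noteq> {}" "subset.chain ?F C"
    then have "A \<subseteq> \<Union>C"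
      unfolding pred_on.chain_def by blast
    then show "\<Union>C \<in> ?F"
      using subring_Union_chain[OF C] chain[OF C] by simp
  qed (use assms in auto)
  then show ?thesis
    by fastforce
qed

text \<open>A subring maximal among those above \<open>A\<close> that miss part of \<open>Y\<close>
  is a maximal subring, since anything larger contains \<open>Y\<close> and hence everything.
  Finiteness of \<open>Y\<close> carries the condition through unions of chains.\<close>

lemma (in ring) has_maximal_subring_if_finitely_generated:
  assumes "subring A R" "A \<noteq> carrier R" "finite Y" "Y \<subseteq> carrier R"
    and gen: "\<And>B. subring B R \<Longrightarrow> A \<subseteq> B \<Longrightarrow> Y \<subseteq> B \<Longrightarrow> B = carrier R"
  shows "has_maximal_subring R"
proof -
  have "\<not> Y \<subseteq> A"
    using assms(2,4) gen[OF assms(1)] by blast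
  have "\<exists>M. subring M R \<and> A \<subseteq> M \<and> \<not> Y \<subseteq> M \<and>
    (\<forall>B. subring B R \<longrightarrow> M \<subseteq> B \<longrightarrow> \<not> Y \<subseteq> B \<longrightarrow> B = M)"
  proof (rule exists_maximal_subring_with)
    fix C assume C: "C \<noteq> {}" "subset.chain {B. subring B R \<and> A \<subseteq> B \<and> \<not> Y \<subseteq> B} C"
    show "\<not> Y \<subseteq> \<Union>C"
    proof
      assume "Y \<subseteq> \<Union>C"
      then obtain B where "B \<in> C" "Y \<subseteq> B"
        by (rule finite_subset_Union_chain[OF assms(3) _ C])
      then show False
        using C(2) by (auto simp: pred_on.chain_def)
    qed
  qed fact+
  then obtain M where M: "subring M R" "A \<subseteq> M" "\<not> Y \<subseteq> M"
    "\<And>B. subring B R \<Longrightarrow> M \<subseteq> B \<Longrightarrow> \<not> Y \<subseteq> B \<Longrightarrow> B = M"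
    by auto
  have "S' = M \<or> S' = carrier R" if "subring S' R" "M \<subseteq> S'" for S'
    using that M gen[of S'] by (cases "Y \<subseteq> S'") auto
  moreover have "M \<noteq> carrier R"
    using M(3) assms(4) by auto
  ultimately show ?thesis
    using M(1) unfolding has_maximal_subring_def maximal_subring_def by blast
qed

text \<open>The preimage \<open>M\<close> of a maximal subring contains the kernel, so a subring
  above \<open>M\<close> is determined by its image, and the correspondence preserves
  maximality.\<close>

lemma has_maximal_subring_if_surjective_hom:
  assumes "ring_hom_ring R S h" "h ` carrier R = carrier S" "has_maximal_subring S"
  shows "has_maximal_subring R"
proof -
  interpret ring_hom_ring R S h by fact
  obtain N where N: "subring N S" "N \<noteq> carrier S"
    "\<And>S'. subring S' S \<Longrightarrow> N \<subseteq> S' \<Longrightarrow> S' = N \<or> S' = carrier S"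
    using assms(3) unfolding has_maximal_subring_def maximal_subring_def by blast
  define M where "M = {r \<in> carrier R. h r \<in> N}"
  have M: "subring M R"
    using subringE[OF N(1)] unfolding M_def by (intro R.subringI) auto
  have imM: "h ` M = N"
    using subringE(1)[OF N(1)] assms(2)[symmetric] unfolding M_def by (auto simp: image_iff subset_iff)
  have "M \<noteq> carrier R"
    using imM assms(2) N(2) by blast
  moreover have "S' = M \<or> S' = carrier R" if S': "subring S' R" "M \<subseteq> S'" for S'
  proof -
    have "subring (h ` S') S"
      using S'(1) by (rule img_is_subring)
    then consider "h ` S' = N" | "h ` S' = carrier S"
      using N(3) imM S'(2) by blast
    then show ?thesis
    proof cases
      case 1
      then show ?thesis
        using S' subringE(1)[OF S'(1)] unfolding M_def by blast
    next
      case 2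
      have "r \<in> S'" if r: "r \<in> carrier R" for r
      proof -
        obtain s where s: "s \<in> S'" "h r = h s"
          using 2 r by (metis hom_closed imageE)
        have sR: "s \<in> carrier R"
          using s S' subringE(1) by blast
        have "h (r \<ominus>\<^bsub>R\<^esub> s) = \<zero>\<^bsub>S\<^esub>"
          using r sR s(2) by (simp add: R.minus_eq S.r_neg)
        then have "r \<ominus>\<^bsub>R\<^esub> s \<in> S'"
          using S'(2) r sR subringE(2)[OF N(1)] unfolding M_def by auto
        then have "(r \<ominus>\<^bsub>R\<^esub> s) \<oplus>\<^bsub>R\<^esub> s \<in> S'"
          using subringE(7)[OF S'(1)] s(1) by blast
        then show ?thesis
          using r sR by (simp add: R.minus_eq R.a_assoc R.l_neg)
      qed
      then show ?thesis
        using subringE(1)[OF S'(1)] by blast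
    qed
  qed
  ultimately show ?thesis
    using M unfolding has_maximal_subring_def maximal_subring_def by blast
qed

section \<open>Horner sums and adjunction\<close>

text \<open>Polynomials are coefficient lists from the constant term upwards, possibly with trailing
  zeros. A nonzero polynomial therefore reads \<open>\<not> set cs \<subseteq> {\<zero>}\<close>,
  and a monic one \<open>cs @ [\<one>]\<close>.\<close>

primrec horner :: "('a, 'b) ring_scheme \<Rightarrow> 'a \<Rightarrow> 'a list \<Rightarrow> 'a" where
  "horner R x [] = \<zero>\<^bsub>R\<^esub>"
| "horner R x (c # cs) = c \<oplus>\<^bsub>R\<^esub> x \<otimes>\<^bsub>R\<^esub> horner R x cs"

text \<open>In the commutative case this is A[x]; the explicit form hands over the coefficients of
  each element.\<close>

definition adjoin :: "('a, 'b) ring_scheme \<Rightarrow> 'a set \<Rightarrow> 'a \<Rightarrow> 'a set" where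
  "adjoin R A x = horner R x ` lists A"

text \<open>The shorter list is padded and nothing is trimmed, so two lists of length m have a sum
  of length m; the degree bounds in the integral closure argument rely on this.\<close>

fun list_sum :: "('a, 'b) ring_scheme \<Rightarrow> 'a list \<Rightarrow> 'a list \<Rightarrow> 'a list" where
  "list_sum R [] bs = bs"
| "list_sum R as [] = as"
| "list_sum R (a # as) (b # bs) = (a \<oplus>\<^bsub>R\<^esub> b) # list_sum R as bs"

lemma length_list_sum [simp]: "length (list_sum R as bs) = max (length as) (length bs)"
  by (induction R as bs rule: list_sum.induct) auto

context ring
begin

lemma horner_closed [simp, intro]:
  "x \<in> carrier R \<Longrightarrow> set cs \<subseteq> carrier R \<Longrightarrow> horner R x cs \<in> carrier R"
  by (induction cs) auto

lemma horner_snoc: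
  assumes "x \<in> carrier R" "set cs \<subseteq> carrier R" "c \<in> carrier R"
  shows "horner R x (cs @ [c]) = horner R x cs \<oplus> x [^] length cs \<otimes> c"
  using assms(2)
proof (induction cs)
  case (Cons a cs)
  have "x [^] length (a # cs) = x \<otimes> x [^] length cs"
    using assms(1) nat_pow_Suc2 by simp
  with Cons show ?case
    using assms(1,3) by (simp add: a_assoc r_distr m_assoc del: nat_pow_Suc)
qed (use assms in simp)

lemma list_sum_closed:
  assumes "set as \<subseteq> A" "set bs \<subseteq> A" "\<And>a b. a \<in> A \<Longrightarrow> b \<in> A \<Longrightarrow> a \<oplus> b \<in> A"
  shows "set (list_sum R as bs) \<subseteq> A"
  using assms by (induction R as bs rule: list_sum.induct) auto

lemma horner_list_sum:
  assumes "x \<in> carrier R" "set as \<subseteq> carrier R" "set bs \<subseteq> carrier R"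
  shows "horner R x (list_sum R as bs) = horner R x as \<oplus> horner R x bs"
  using assms(2,3)
proof (induction as arbitrary: bs)
  case (Cons a as)
  then show ?case
    using assms(1) by (cases bs) (auto simp: r_distr a_ac)
qed (use assms(1) in auto)

end

context cring
begin

lemma horner_map_mult:
  assumes "x \<in> carrier R" "set cs \<subseteq> carrier R" "a \<in> carrier R"
  shows "horner R x (map ((\<otimes>) a) cs) = a \<otimes> horner R x cs"
  using assms by (induction cs) (auto simp: r_distr m_lcomm)

context
  fixes A x
  assumes A: "subring A R" and x: "x \<in> carrier R"
begin

lemma adjoin_add:
  assumes "s \<in> adjoin R A x" "t \<in> adjoin R A x"
  shows "s \<oplus> t \<in> adjoin R A x"
proof -
  obtain as bs where "set as \<subseteq> A" "set bs \<subseteq> A" "s = horner R x as" "t = horner R x bs"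
    using assms by (auto simp: adjoin_def)
  moreover from this have "s \<oplus> t = horner R x (list_sum R as bs)"
    using subringE(1)[OF A] x by (subst horner_list_sum) auto
  ultimately show ?thesis
    using list_sum_closed[of as A bs] subringE(7)[OF A] by (auto simp: adjoin_def)
qed

lemma adjoin_scale:
  assumes "s \<in> adjoin R A x" "a \<in> A"
  shows "a \<otimes> s \<in> adjoin R A x"
proof -
  obtain as where "set as \<subseteq> A" "s = horner R x as"
    using assms by (auto simp: adjoin_def)
  moreover from this have "a \<otimes> s = horner R x (map ((\<otimes>) a) as)"
    using subringE(1)[OF A] x assms(2) by (subst horner_map_mult) auto
  moreover have "set (map ((\<otimes>) a) as) \<subseteq> A"
    using calculation(1) subringE(6)[OF A] assms(2) by auto
  ultimately show ?thesis
    unfolding adjoin_def by (metis image_eqI in_lists_conv_set subsetD)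
qed

lemma adjoin_incl: "A \<subseteq> adjoin R A x"
proof
  fix a assume a: "a \<in> A"
  then have "a = horner R x [a]"
    using subringE(1)[OF A] x by auto
  then show "a \<in> adjoin R A x"
    using a unfolding adjoin_def by (metis Cons_in_lists_iff image_eqI lists.Nil)
qed

lemma adjoin_times_gen:
  assumes "s \<in> adjoin R A x"
  shows "x \<otimes> s \<in> adjoin R A x"
proof -
  obtain as where as: "set as \<subseteq> A" "s = horner R x as"
    using assms by (auto simp: adjoin_def)
  then have "x \<otimes> s = horner R x (\<zero> # as)"
    using subringE(1)[OF A] x by (auto intro!: l_zero[symmetric])
  then show ?thesis
    using as subringE(2)[OF A] unfolding adjoin_def by (metis Cons_in_lists_iff image_eqI in_lists_conv_set subsetD)
qed

lemma adjoin_closed: "adjoin R A x \<subseteq> carrier R"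
  using subringE(1)[OF A] x by (auto simp: adjoin_def)

lemma adjoin_subring: "subring (adjoin R A x) R"
proof (rule subringI)
  show "adjoin R A x \<subseteq> carrier R"
    by (rule adjoin_closed)
  show "\<one> \<in> adjoin R A x"
    using adjoin_incl subringE(3)[OF A] by blast
next
  fix s assume s: "s \<in> adjoin R A x"
  have "\<ominus> \<one> \<otimes> s \<in> adjoin R A x"
    using s subringE(3,5)[OF A] by (intro adjoin_scale) auto
  then show "\<ominus> s \<in> adjoin R A x"
    using s adjoin_closed by (auto simp: l_minus)
next
  fix s t assume s: "s \<in> adjoin R A x" and t: "t \<in> adjoin R A x"
  then show "s \<oplus> t \<in> adjoin R A x"
    by (rule adjoin_add)
  obtain as where "set as \<subseteq> A" "s = horner R x as"
    using s by (auto simp: adjoin_def)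
  moreover have "set as \<subseteq> A \<Longrightarrow> horner R x as \<otimes> t \<in> adjoin R A x"
  proof (induction as)
    case Nil
    have "\<zero> \<in> adjoin R A x"
      using adjoin_incl subringE(2)[OF A] by blast
    then show ?case
      using t adjoin_closed by auto
  next
    case (Cons c cs)
    have "horner R x (c # cs) \<otimes> t = c \<otimes> t \<oplus> x \<otimes> (horner R x cs \<otimes> t)"
      using Cons.prems t adjoin_closed subringE(1)[OF A] x
      by (subst m_assoc[symmetric]) (auto simp: l_distr subset_iff)
    then show ?case
      using Cons t by (auto intro!: adjoin_add adjoin_scale adjoin_times_gen)
  qed
  ultimately show "s \<otimes> t \<in> adjoin R A x"
    by blast
qed

lemma adjoin_gen: "x \<in> adjoin R A x"
  using adjoin_times_gen[OF adjoin_incl[THEN subsetD, OF subringE(3)[OF A]]] x by simp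

end

end

section \<open>Fields with a transcendental element\<close>

text \<open>Transcendence of \<open>x\<close> over \<open>L\<close>, stated for an arbitrary subset
  \<open>L\<close>.\<close>

definition power_independent :: "('a, 'b) ring_scheme \<Rightarrow> 'a set \<Rightarrow> 'a \<Rightarrow> bool" where
  "power_independent R L x \<longleftrightarrow>
    (\<forall>cs. set cs \<subseteq> L \<longrightarrow> horner R x cs = \<zero>\<^bsub>R\<^esub> \<longrightarrow> set cs \<subseteq> {\<zero>\<^bsub>R\<^esub>})"

lemma (in ring) horner_zeros:
  assumes "x \<in> carrier R" "set cs \<subseteq> {\<zero>}"
  shows "horner R x cs = \<zero>"
  using assms by (induction cs) auto

context cring
begin

lemma power_independentD:
  assumes "power_independent R L x" "c \<in> L" "p \<in> adjoin R L x" "c \<oplus> x \<otimes> p = \<zero>" "x \<in> carrier R"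
  shows "c = \<zero>" "p = \<zero>"
proof -
  obtain ds where ds: "set ds \<subseteq> L" "p = horner R x ds"
    using assms(3) by (auto simp: adjoin_def)
  have "set (c # ds) \<subseteq> {\<zero>}"
    using assms(1)[unfolded power_independent_def, rule_format, of "c # ds"] assms(2,4) ds
    by auto
  then show "c = \<zero>" "p = \<zero>"
    using ds(2) horner_zeros[OF assms(5)] by auto
qed

text \<open>The entries are c + x p with c in L and p in L[x]; transcendence separates the constant
  term from the rest.\<close>

lemma list_sum_eq_zeros:
  assumes L: "subring L R" and x: "x \<in> carrier R" "power_independent R L x"
    and "set cs \<subseteq> L" "set ps \<subseteq> adjoin R L x"
    and "set (list_sum R cs (map ((\<otimes>) x) ps)) \<subseteq> {\<zero>}"
  shows "set cs \<subseteq> {\<zero>} \<and> set ps \<subseteq> {\<zero>}"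
  using assms(4-)
proof (induction cs arbitrary: ps)
  case Nil
  have "p = \<zero>" if "p \<in> set ps" for p
  proof (rule power_independentD(2)[OF x(2) _ _ _ x(1)])
    show "\<zero> \<in> L"
      using L by (rule subringE)
    show "p \<in> adjoin R L x" "\<zero> \<oplus> x \<otimes> p = \<zero>"
      using that Nil by auto
  qed
  then show ?case
    by auto
next
  case (Cons c cs)
  show ?case
  proof (cases ps)
    case Nil
    then show ?thesis
      using Cons.prems by auto
  next
    case (Cons p ps')
    then have "c \<oplus> x \<otimes> p = \<zero>" "c \<in> L" "p \<in> adjoin R L x"
      using Cons.prems by auto
    then show ?thesis
      using power_independentD[OF x(2) _ _ _ x(1)] Cons.IH[of ps'] Cons.prems Cons by simp
  qed
qed

text \<open>A polynomial in x with coefficients in L[y] is rearranged by powers of y. The last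
  clause guarantees that a nonzero array of double coefficients does not turn into the zero
  polynomial over L[x].\<close>

lemma horner_swap:
  assumes L: "subring L R" and x: "x \<in> carrier R" "power_independent R L x" and y: "y \<in> carrier R"
    and "\<forall>c\<in>set css. set c \<subseteq> L"
  shows "\<exists>ps. set ps \<subseteq> adjoin R L x \<and> horner R x (map (horner R y) css) = horner R y ps \<and>
    (set ps \<subseteq> {\<zero>} \<longrightarrow> (\<forall>c\<in>set css. set c \<subseteq> {\<zero>}))"
  using assms(5)
proof (induction css)
  case Nil
  show ?case
    by (intro exI[of _ "[]"]) simp
next
  case (Cons c css)
  then obtain ps where ps: "set ps \<subseteq> adjoin R L x"
    "horner R x (map (horner R y) css) = horner R y ps"
    "set ps \<subseteq> {\<zero>} \<longrightarrow> (\<forall>c\<in>set css. set c \<subseteq> {\<zero>})"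
    by auto
  have c: "set c \<subseteq> L"
    using Cons.prems by simp
  note LR = subringE(1)[OF L] and aR = adjoin_closed[OF L x(1)]
  have xps: "set (map ((\<otimes>) x) ps) \<subseteq> adjoin R L x"
    using ps(1) adjoin_times_gen[OF L x(1)] by auto
  \<comment> \<open>The row \<open>c\<close> contributes the terms free of x; the rows already
    rearranged are shifted by one power of x.\<close>
  let ?ps = "list_sum R c (map ((\<otimes>) x) ps)"
  have "set ?ps \<subseteq> adjoin R L x"
    using c xps adjoin_incl[OF L x(1)] adjoin_add[OF L x(1)] by (intro list_sum_closed) auto
  moreover have "horner R x (map (horner R y) (c # css)) = horner R y ?ps"
  proof -
    have "horner R y ?ps = horner R y c \<oplus> horner R y (map ((\<otimes>) x) ps)"
      using y c LR xps aR by (intro horner_list_sum) blast+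
    also have "horner R y (map ((\<otimes>) x) ps) = x \<otimes> horner R y ps"
      using y x(1) ps(1) aR by (intro horner_map_mult) blast+
    finally show ?thesis
      using ps(2) by simp
  qed
  moreover have "\<forall>c\<in>set (c # css). set c \<subseteq> {\<zero>}" if "set ?ps \<subseteq> {\<zero>}"
    using list_sum_eq_zeros[OF L x c ps(1) that] ps(3) by simp
  ultimately show ?case
    by blast
qed

text \<open>Each power of \<open>u\<close> is cancelled by as many factors \<open>w\<close>. The
  exponent is one above the formal degree, so that it also fits the empty list.\<close>

lemma horner_clear_denominators:
  assumes "subring A R" "w \<in> A" "u \<in> carrier R" "w \<otimes> u = \<one>" "set ds \<subseteq> A"
  shows "w [^] length ds \<otimes> horner R u ds \<in> A"
proof -
  note AR = subringE(1)[OF assms(1)]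
  have pw: "w [^] (n::nat) \<in> A" for n
    using assms(2) subringE(3,6)[OF assms(1)] by (induction n) auto
  show ?thesis
    using assms(5)
  proof (induction ds)
    case Nil
    then show ?case
      using subringE(2)[OF assms(1)] by simp
  next
    case (Cons d ds)
    then have d: "d \<in> A" "d \<in> carrier R" "horner R u ds \<in> carrier R" "w \<in> carrier R"
      using AR assms(2,3) by auto
    have "w [^] length (d # ds) \<otimes> horner R u (d # ds)
      = w [^] length (d # ds) \<otimes> d \<oplus> (w [^] length ds \<otimes> horner R u ds) \<otimes> (w \<otimes> u)"
      using d assms(3) by (simp add: r_distr m_ac)
    also have "\<dots> = w [^] length (d # ds) \<otimes> d \<oplus> (w [^] length ds \<otimes> horner R u ds)"
      using d assms(4) by simp
    finally show ?case
      using Cons d pw[of "length (d # ds)"] subringE(6,7)[OF assms(1)] by simp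
  qed
qed

text \<open>The classical passage from a root y with leading coefficient c to the integral element c
  y. Multiplying by c^n instead of c^(n-1), where n is the degree, leaves the extra factor c on the
  right, to be cancelled in a field.\<close>

lemma horner_make_monic:
  assumes "subring A R" "c \<in> A" "y \<in> carrier R" "set cs \<subseteq> A"
  shows "\<exists>ds. set ds \<subseteq> A \<and> c [^] length cs \<otimes> horner R y (cs @ [c]) = c \<otimes> horner R (c \<otimes> y) (ds @ [\<one>])"
proof -
  note AR = subringE(1)[OF assms(1)]
  have pw: "c [^] (n::nat) \<in> A" for n
    using assms(2) subringE(3,6)[OF assms(1)] by (induction n) auto
  show ?thesis
    using assms(4)
  proof (induction cs)
    case Nil
    then show ?case
      using assms AR by (intro exI[of _ "[]"]) auto
  next
    case (Cons d cs)
    then obtain ds where ds: "set ds \<subseteq> A"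
      "c [^] length cs \<otimes> horner R y (cs @ [c]) = c \<otimes> horner R (c \<otimes> y) (ds @ [\<one>])"
      by auto
    have sub: "set cs \<subseteq> carrier R" "set ds \<subseteq> carrier R"
      using Cons.prems AR ds(1) by auto
    have R: "d \<in> carrier R" "c \<in> carrier R" "horner R y (cs @ [c]) \<in> carrier R"
      "horner R (c \<otimes> y) (ds @ [\<one>]) \<in> carrier R"
      using Cons.prems assms(2,3) AR sub by (auto simp: subset_iff)
    have "c [^] length (d # cs) \<otimes> horner R y ((d # cs) @ [c])
      = c \<otimes> (c [^] length cs \<otimes> d) \<oplus> (c \<otimes> y) \<otimes> (c [^] length cs \<otimes> horner R y (cs @ [c]))"
      using R assms(3) by (simp add: r_distr m_ac)
    also have "\<dots> = c \<otimes> horner R (c \<otimes> y) (((c [^] length cs \<otimes> d) # ds) @ [\<one>])"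
      unfolding ds(2) using R assms(3) by (simp add: r_distr m_ac)
    finally show ?case
      using ds(1) Cons.prems pw subringE(6)[OF assms(1)]
      by (intro exI[of _ "(c [^] length cs \<otimes> d) # ds"]) simp
  qed
qed

end

section \<open>Subrings maximal for the transcendence of an element\<close>

context field
begin

lemma exists_maximal_power_independent:
  assumes "subring L\<^sub>0 R" "power_independent R L\<^sub>0 x"
  shows "\<exists>L. subring L R \<and> L\<^sub>0 \<subseteq> L \<and> power_independent R L x \<and>
    (\<forall>B. subring B R \<longrightarrow> L \<subseteq> B \<longrightarrow> power_independent R B x \<longrightarrow> B = L)"
proof (rule exists_maximal_subring_with)
  fix C assume C: "C \<noteq> {}" "subset.chain {B. subring B R \<and> L\<^sub>0 \<subseteq> B \<and> power_independent R B x} C"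
  show "power_independent R (\<Union>C) x"
    unfolding power_independent_def
  proof (intro allI impI)
    fix cs assume cs: "set cs \<subseteq> \<Union>C" "horner R x cs = \<zero>"
    obtain B where "B \<in> C" "set cs \<subseteq> B"
      by (rule finite_subset_Union_chain[OF _ cs(1) C]) auto
    moreover from this have "power_independent R B x"
      using C(2) by (auto simp: pred_on.chain_def)
    ultimately show "set cs \<subseteq> {\<zero>}"
      using cs(2) by (auto simp: power_independent_def)
  qed
qed fact+

context
  fixes L x
  assumes L: "subring L R" and x: "x \<in> carrier R" "power_independent R L x"
    and max: "\<And>B. subring B R \<Longrightarrow> L \<subseteq> B \<Longrightarrow> power_independent R B x \<Longrightarrow> B = L"
begin

text \<open>If x stays transcendental over L[y], maximality puts y into L and the polynomial y - t
  serves. Otherwise a relation for x over L[y] is reread as a relation for y over L[x].\<close>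

lemma maximal_power_independent_algebraic:
  assumes y: "y \<in> carrier R"
  shows "\<exists>ps. set ps \<subseteq> adjoin R L x \<and> horner R y ps = \<zero> \<and> \<not> set ps \<subseteq> {\<zero>}"
proof (cases "power_independent R (adjoin R L y) x")
  case True
  then have "adjoin R L y = L"
    using max adjoin_subring[OF L y] adjoin_incl[OF L y] by blast
  then have "y \<in> adjoin R L x"
    using adjoin_gen[OF L y] adjoin_incl[OF L x(1)] by blast
  moreover have "\<ominus> \<one> \<in> adjoin R L x"
    using subringE(3,5)[OF adjoin_subring[OF L x(1)]] by blast
  moreover have "horner R y [y, \<ominus> \<one>] = \<zero>"
    using y by (simp add: r_minus r_neg)
  moreover have "\<ominus> \<one> \<noteq> \<zero>"
    by (metis minus_equality one_closed one_not_zero minus_minus minus_zero)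
  ultimately show ?thesis
    by (intro exI[of _ "[y, \<ominus> \<one>]"]) auto
next
  case False
  then obtain cs where cs: "set cs \<subseteq> adjoin R L y" "horner R x cs = \<zero>" "\<not> set cs \<subseteq> {\<zero>}"
    by (auto simp: power_independent_def)
  have "\<exists>css. cs = map (horner R y) css \<and> (\<forall>c\<in>set css. set c \<subseteq> L)"
    using cs(1)
  proof (induction cs)
    case (Cons c cs)
    then obtain css where "cs = map (horner R y) css" "\<forall>c\<in>set css. set c \<subseteq> L"
      by auto
    moreover obtain ds where "c = horner R y ds" "set ds \<subseteq> L"
      using Cons.prems by (auto simp: adjoin_def)
    ultimately show ?case
      by (intro exI[of _ "ds # css"]) auto
  qed auto
  then obtain css where css: "cs = map (horner R y) css" "\<forall>c\<in>set css. set c \<subseteq> L"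
    by blast
  obtain ps where "set ps \<subseteq> adjoin R L x" "horner R x cs = horner R y ps"
    "set ps \<subseteq> {\<zero>} \<longrightarrow> (\<forall>c\<in>set css. set c \<subseteq> {\<zero>})"
    using horner_swap[OF L x y css(2)] css(1) by auto
  moreover have "\<not> (\<forall>c\<in>set css. set c \<subseteq> {\<zero>})"
    using cs(3) css(1) horner_zeros[OF y] by auto
  ultimately show ?thesis
    using cs(2) by auto
qed

text \<open>Finitely many coefficients in L[1/c] have a common denominator c^m, so adjoining 1/c
  creates no relation for x, and maximality gives L[1/c] = L.\<close>

lemma maximal_power_independent_inv_closed:
  assumes c: "c \<in> L" "c \<noteq> \<zero>"
  shows "inv c \<in> L"
proof -
  have cR: "c \<in> carrier R" and cU: "c \<in> Units R"
    using c subringE(1)[OF L] field_Units by auto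
  then have ic: "inv c \<in> carrier R" "c \<otimes> inv c = \<one>"
    by auto
  have "power_independent R (adjoin R L (inv c)) x"
    unfolding power_independent_def
  proof (intro allI impI)
    fix cs assume cs: "set cs \<subseteq> adjoin R L (inv c)" "horner R x cs = \<zero>"
    have pw: "c [^] (n::nat) \<in> L" for n
      using c(1) subringE(3,6)[OF L] by (induction n) auto
    have "\<exists>m::nat. \<forall>d\<in>set cs. c [^] m \<otimes> d \<in> L"
      using cs(1)
    proof (induction cs)
      case (Cons d cs)
      then obtain m :: nat where m: "\<forall>d\<in>set cs. c [^] m \<otimes> d \<in> L"
        by auto
      obtain ds where ds: "set ds \<subseteq> L" "d = horner R (inv c) ds"
        using Cons.prems by (auto simp: adjoin_def)
      have dR: "set (d # cs) \<subseteq> carrier R"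
        using Cons.prems adjoin_closed[OF L ic(1)] by blast
      let ?n = "length ds"
      have "c [^] ?n \<otimes> d \<in> L"
        using horner_clear_denominators[OF L c(1) ic ds(1)] ds(2) by simp
      moreover have "c [^] (m + ?n) \<otimes> e = c [^] m \<otimes> (c [^] ?n \<otimes> e)"
        "c [^] (m + ?n) \<otimes> e = c [^] ?n \<otimes> (c [^] m \<otimes> e)" if "e \<in> carrier R" for e
        using cR that by (simp_all add: nat_pow_mult[symmetric] m_ac)
      ultimately have "\<forall>e\<in>set (d # cs). c [^] (m + ?n) \<otimes> e \<in> L"
        using m dR subringE(6)[OF L] pw by (metis in_mono set_ConsD)
      then show ?case
        by blast
    qed auto
    then obtain m :: nat where m: "\<forall>d\<in>set cs. c [^] m \<otimes> d \<in> L"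
      by blast
    have csR: "set cs \<subseteq> carrier R"
      using cs(1) adjoin_closed[OF L ic(1)] by blast
    have "horner R x (map ((\<otimes>) (c [^] m)) cs) = \<zero>"
      using cs(2) csR cR x(1) by (subst horner_map_mult) auto
    then have "set (map ((\<otimes>) (c [^] m)) cs) \<subseteq> {\<zero>}"
      using x(2)[unfolded power_independent_def, rule_format, of "map ((\<otimes>) (c [^] m)) cs"] m by auto
    moreover have "c [^] m \<noteq> \<zero>"
      using cU Units_pow_closed[of c m] by (simp add: field_Units)
    moreover have "c [^] m \<in> carrier R"
      using cR by simp
    ultimately have "d = \<zero>" if "d \<in> set cs" for d
      using that csR integral[of "c [^] m" d] by auto
    then show "set cs \<subseteq> {\<zero>}"
      by blast
  qed
  then have "adjoin R L (inv c) = L"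
    using max adjoin_subring[OF L ic(1)] adjoin_incl[OF L ic(1)] by blast
  then show ?thesis
    using adjoin_gen[OF L ic(1)] by blast
qed

end

end

section \<open>Subrings maximal without a given inverse\<close>

context field
begin

lemma subring_nat_pow_closed:
  assumes "subring M R" "c \<in> M"
  shows "c [^] (n::nat) \<in> M"
  using assms subringE(3,6)[OF assms(1)] by (induction n) auto

text \<open>A subring that is maximal among those avoiding \<open>inv x\<close> behaves like a valuation ring: \<open>x\<close> lies
  in its Jacobson radical, and by Nakayama's argument it is integrally closed.\<close>

context
  fixes M x
  assumes M: "subring M R" and x: "x \<in> M" "x \<noteq> \<zero>" "inv x \<notin> M"
    and max: "\<And>B. subring B R \<Longrightarrow> M \<subseteq> B \<Longrightarrow> inv x \<notin> B \<Longrightarrow> B = M"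
begin

lemma avoiding_inv_facts:
  shows "x \<in> carrier R" "inv x \<in> carrier R" "x \<otimes> inv x = \<one>"
  using subringE(1)[OF M] x(1,2) field_Units by auto

lemma avoiding_inv_adjoin:
  assumes "y \<in> carrier R" "y \<notin> M"
  shows "inv x \<in> adjoin R M y"
  using assms(2) max[OF adjoin_subring adjoin_incl, OF M assms(1) M assms(1)]
    adjoin_gen[OF M assms(1)] by auto

text \<open>Put w = 1 - x r. If 1/w were outside M, then 1/x would be a polynomial in 1/w over M,
  and clearing denominators would put w^n / x into M. But w^n = 1 - x q with q in M, so 1/x - q and
  hence 1/x would lie in M.\<close>

lemma avoiding_inv_jacobson:
  assumes "r \<in> M"
  shows "\<one> \<ominus> x \<otimes> r \<noteq> \<zero>" "inv (\<one> \<ominus> x \<otimes> r) \<in> M"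
proof -
  note MR = subringE(1)[OF M] and x' = avoiding_inv_facts
  have r: "r \<in> carrier R"
    using assms MR by blast
  have xr: "x \<otimes> s \<in> M" if "s \<in> M" for s
    using that x(1) subringE(6)[OF M] by blast
  have minus: "s \<ominus> t \<in> M" if "s \<in> M" "t \<in> M" for s t
    using that subringE(5,7)[OF M] by (simp add: a_minus_def)
  let ?w = "\<one> \<ominus> x \<otimes> r"
  have wM: "?w \<in> M"
    using minus xr subringE(3)[OF M] assms by blast
  then have wR: "?w \<in> carrier R"
    using MR by blast
  show w0: "?w \<noteq> \<zero>"
  proof
    assume "?w = \<zero>"
    then have "x \<otimes> r = \<one>"
      using x' r by (metis m_closed one_closed r_right_minus_eq)
    then have "r = inv x"
      using r x' by (metis comm_inv_char)
    then show False
      using assms x(3) by blast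
  qed
  have iw: "inv ?w \<in> carrier R" "?w \<otimes> inv ?w = \<one>"
    using wR w0 field_Units by auto
  show "inv ?w \<in> M"
  proof (rule ccontr)
    assume "inv ?w \<notin> M"
    then obtain rs where rs: "set rs \<subseteq> M" "inv x = horner R (inv ?w) rs"
      using avoiding_inv_adjoin[OF iw(1)] by (auto simp: adjoin_def)
    have pw: "\<exists>q\<in>M. ?w [^] n = \<one> \<ominus> x \<otimes> q" for n :: nat
    proof (induction n)
      case 0
      show ?case
        using subringE(2)[OF M] x' by (intro bexI[of _ \<zero>]) (auto simp: a_minus_def)
    next
      case (Suc n)
      then obtain q where q: "q \<in> M" "?w [^] n = \<one> \<ominus> x \<otimes> q"
        by blast
      have qR: "q \<in> carrier R"
        using q MR by blast
      have "(\<one> \<ominus> x \<otimes> q) \<otimes> (\<one> \<ominus> x \<otimes> r) = \<one> \<ominus> x \<otimes> (q \<oplus> (r \<ominus> q \<otimes> (x \<otimes> r)))"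
        using qR r x'(1) by algebra
      moreover have "q \<oplus> (r \<ominus> q \<otimes> (x \<otimes> r)) \<in> M"
        using q(1) assms xr minus subringE(6,7)[OF M] by auto
      ultimately show ?case
        using q(2) by auto
    qed
    obtain q where q: "q \<in> M" "?w [^] length rs = \<one> \<ominus> x \<otimes> q"
      using pw by blast
    then have qR: "q \<in> carrier R"
      using MR by blast
    have "(\<one> \<ominus> x \<otimes> q) \<otimes> inv x \<in> M"
      using horner_clear_denominators[OF M wM iw rs(1)] rs(2) q(2) by simp
    moreover have "inv x = (\<one> \<ominus> x \<otimes> q) \<otimes> inv x \<oplus> q \<otimes> (x \<otimes> inv x)"
      using qR x'(1,2) by algebra
    then have "inv x = (\<one> \<ominus> x \<otimes> q) \<otimes> inv x \<oplus> q"
      using qR x'(3) by simp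
    ultimately have "inv x \<in> M"
      using q(1) subringE(7)[OF M] by metis
    with x(3) show False ..
  qed
qed

text \<open>For integral z outside M, the ring M[z] is a finitely generated M-module containing 1/x.
  With the least number of powers of z as generators, the Jacobson property makes the last one
  redundant, a contradiction.\<close>

lemma avoiding_inv_integrally_closed:
  assumes z: "z \<in> carrier R" and cs: "set cs \<subseteq> M" "horner R z (cs @ [\<one>]) = \<zero>"
  shows "z \<in> M"
proof (rule ccontr)
  assume "z \<notin> M"
  note MR = subringE(1)[OF M] and x' = avoiding_inv_facts
  \<comment> \<open>The M-module generated by the first m powers of z, starting from z^0; for m = 0
    it is the zero module.\<close>
  define span where "span m = horner R z ` {ds. set ds \<subseteq> M \<and> length ds = m}" for m
  have scale: "a \<otimes> s \<in> span m" if as: "a \<in> M" "s \<in> span m" for a s m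
  proof -
    obtain ds where ds: "set ds \<subseteq> M" "length ds = m" "s = horner R z ds"
      using as by (auto simp: span_def)
    then have "a \<otimes> s = horner R z (map ((\<otimes>) a) ds)"
      using as(1) MR z by (subst horner_map_mult) auto
    moreover have "set (map ((\<otimes>) a) ds) \<subseteq> M"
      using ds(1) as(1) subringE(6)[OF M] by auto
    ultimately show ?thesis
      using ds(2) by (auto simp: span_def)
  qed
  have add: "s \<oplus> t \<in> span m" if st: "s \<in> span m" "t \<in> span m" for s t m
  proof -
    obtain ds es where "set ds \<subseteq> M" "length ds = m" "s = horner R z ds"
      "set es \<subseteq> M" "length es = m" "t = horner R z es"
      using st by (auto simp: span_def)
    moreover from this have "s \<oplus> t = horner R z (list_sum R ds es)"
      using MR z by (subst horner_list_sum) auto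
    ultimately show ?thesis
      using list_sum_closed[of ds M es] subringE(7)[OF M] by (auto simp: span_def)
  qed
  have pow_span: "z [^] length cs \<in> span (length cs)"
  proof -
    have h: "horner R z cs \<in> span (length cs)" "horner R z cs \<in> carrier R"
      using cs(1) MR z by (auto simp: span_def)
    then have "\<ominus> \<one> \<otimes> horner R z cs \<in> span (length cs)"
      using scale subringE(3,5)[OF M] by blast
    moreover have "horner R z cs \<oplus> z [^] length cs = \<zero>"
      using cs MR z horner_snoc[of z cs \<one>] by auto
    then have "z [^] length cs = \<ominus> \<one> \<otimes> horner R z cs"
      using h(2) z by (metis a_comm l_minus l_one minus_equality nat_pow_closed one_closed)
    ultimately show ?thesis
      by simp
  qed
  define m where "m = (LEAST m. z [^] m \<in> span m)"
  have m: "z [^] m \<in> span m"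
    unfolding m_def using pow_span by (rule LeastI)
  have least: "z [^] k \<notin> span k" if "k < m" for k
    using that unfolding m_def by (rule not_less_Least)
  have "m \<noteq> 0"
    using m by (auto simp: span_def)
  then obtain k where k: "m = Suc k"
    using not0_implies_Suc by blast
  \<comment> \<open>All of M[z] lies in this module: multiplication by z creates at most a term with
    z^m, which folds back because z^m is in \<open>span m\<close>.\<close>
  have adj: "set ds \<subseteq> M \<Longrightarrow> horner R z ds \<in> span m" for ds
  proof (induction ds)
    case Nil
    have "horner R z (replicate m \<zero>) \<in> span m"
      unfolding span_def using subringE(2)[OF M] by (intro imageI) auto
    moreover have "horner R z (replicate m \<zero>) = \<zero>"
      using z by (intro horner_zeros) auto
    ultimately show ?case
      by simp
  next
    case (Cons d ds)
    then obtain es where es: "set es \<subseteq> M" "length es = m" "horner R z ds = horner R z es"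
      by (auto simp: span_def)
    then obtain fs f where fs: "es = fs @ [f]"
      using k by (metis append_butlast_last_id length_0_conv nat.distinct(1))
    have fM: "set fs \<subseteq> M" "f \<in> M" "length fs = k" "d \<in> M"
      using es fs k Cons.prems by auto
    then have fR: "set fs \<subseteq> carrier R" "f \<in> carrier R" "d \<in> carrier R"
      using MR by auto
    have "horner R z (d # ds) = d \<oplus> z \<otimes> (horner R z fs \<oplus> z [^] k \<otimes> f)"
      using es(3) fs fM fR z by (simp add: horner_snoc)
    also have "\<dots> = horner R z (d # fs) \<oplus> f \<otimes> z [^] m"
      using fR z k by (simp add: r_distr m_ac a_assoc horner_closed)
    also have "\<dots> \<in> span m"
    proof (rule add)
      show "horner R z (d # fs) \<in> span m"
        unfolding span_def using fM k by (intro imageI) auto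
    qed (use scale m fM in blast)
    finally show ?case .
  qed
  obtain rs where rs: "set rs \<subseteq> M" "inv x = horner R z rs"
    using avoiding_inv_adjoin[OF z \<open>z \<notin> M\<close>] by (auto simp: adjoin_def)
  have rsR: "set rs \<subseteq> carrier R"
    using rs(1) MR by blast
  have shift: "z [^] (j::nat) \<otimes> horner R z rs \<in> span m" for j
  proof -
    have "z [^] j \<otimes> horner R z rs = horner R z (replicate j \<zero> @ rs)"
    proof (induction j)
      case (Suc j)
      have "z [^] Suc j \<otimes> horner R z rs = z \<otimes> (z [^] j \<otimes> horner R z rs)"
        using rsR z by (simp add: m_ac)
      moreover have "set (replicate j \<zero> @ rs) \<subseteq> carrier R"
        using rsR by auto
      ultimately show ?case
        using Suc z by (simp del: nat_pow_Suc)
    qed (use rsR z in auto)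
    moreover have "set (replicate j \<zero> @ rs) \<subseteq> M"
      using rs(1) subringE(2)[OF M] by auto
    ultimately show ?thesis
      using adj by metis
  qed
  \<comment> \<open>Since 1/x lies in M[z], so does z^k / x. Splitting off its top coefficient f
    gives z^k = x h + x f z^k with h in \<open>span k\<close>, and 1 - x f is a unit of M.\<close>
  obtain es where es: "set es \<subseteq> M" "length es = m" "z [^] k \<otimes> inv x = horner R z es"
    using shift[of k] rs(2) by (auto simp: span_def)
  then obtain fs f where fs: "es = fs @ [f]"
    using k by (metis append_butlast_last_id length_0_conv nat.distinct(1))
  have fM: "set fs \<subseteq> M" "f \<in> M" "length fs = k"
    using es fs k by auto
  then have fR: "horner R z fs \<in> carrier R" "set fs \<subseteq> carrier R" "f \<in> carrier R"
    using MR z by (auto intro!: horner_closed)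
  define h where "h = horner R z fs"
  define zk where "zk = z [^] k"
  have zk: "zk \<in> carrier R" and h: "h \<in> carrier R" "h \<in> span k"
    using z fR fM by (auto simp: h_def zk_def span_def)
  have e: "zk \<otimes> inv x = h \<oplus> zk \<otimes> f"
    using es(3) fs fM fR z by (simp add: horner_snoc h_def zk_def)
  have "zk = x \<otimes> (zk \<otimes> inv x)"
    using x' zk m_lcomm[of x zk "inv x"] by simp
  then have zk_eq: "zk = x \<otimes> h \<oplus> (x \<otimes> f) \<otimes> zk"
    unfolding e using x'(1) zk h(1) fR(3) by (metis m_assoc m_closed m_comm r_distr)
  have "(\<one> \<ominus> x \<otimes> f) \<otimes> zk = zk \<ominus> (x \<otimes> f) \<otimes> zk"
    using x'(1) zk fR(3) by algebra
  also have "\<dots> = (x \<otimes> h \<oplus> (x \<otimes> f) \<otimes> zk) \<ominus> (x \<otimes> f) \<otimes> zk"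
    using zk_eq by simp
  also have "\<dots> = x \<otimes> h"
    using x'(1) zk h(1) fR(3) by algebra
  finally have "(\<one> \<ominus> x \<otimes> f) \<otimes> zk = x \<otimes> h" .
  moreover define w where "w = \<one> \<ominus> x \<otimes> f"
  ultimately have wzk: "w \<otimes> zk = x \<otimes> h"
    by simp
  have w: "w \<in> carrier R" "inv w \<in> M" "w \<noteq> \<zero>"
    using avoiding_inv_jacobson[OF fM(2)] x'(1) fR(3) by (auto simp: w_def)
  then have iw: "inv w \<in> carrier R" "inv w \<otimes> w = \<one>"
    using field_Units by auto
  then have "zk = (inv w \<otimes> x) \<otimes> h"
    using wzk w(1) zk h(1) x'(1) m_assoc[of "inv w" w zk] m_assoc[of "inv w" x h] by simp
  moreover have "(inv w \<otimes> x) \<otimes> h \<in> span k"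
    using h(2) w(2) x(1) subringE(6)[OF M] scale by blast
  ultimately have "z [^] k \<in> span k"
    by (simp add: zk_def)
  then show False
    using least k by blast
qed

end

theorem has_maximal_subring_if_power_independent:
  assumes "subring L\<^sub>0 R" "x \<in> carrier R" "power_independent R L\<^sub>0 x"
  shows "has_maximal_subring R"
proof -
  obtain L where L: "subring L R" "power_independent R L x"
    and Lmax: "\<And>B. subring B R \<Longrightarrow> L \<subseteq> B \<Longrightarrow> power_independent R B x \<Longrightarrow> B = L"
    using exists_maximal_power_independent[OF assms(1,3)] by auto
  note LR = subringE(1)[OF L(1)] and adj = adjoin_subring[OF L(1) assms(2)]
  have x0: "x \<noteq> \<zero>"
    using L(2)[unfolded power_independent_def, rule_format, of "[\<zero>, \<one>]"] assms(2)
      subringE(2,3)[OF L(1)] by auto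
  have ix: "inv x \<in> carrier R" "x \<otimes> inv x = \<one>" "inv x \<otimes> x = \<one>"
    using x0 assms(2) field_Units by auto
  \<comment> \<open>An expression p(x) for 1/x would give the relation -1 + x p(x) = 0, which
    transcendence forbids.\<close>
  have ixA: "inv x \<notin> adjoin R L x"
  proof
    assume "inv x \<in> adjoin R L x"
    moreover have "\<ominus> \<one> \<oplus> x \<otimes> inv x = \<zero>"
      using ix by (simp add: l_neg)
    ultimately have "inv x = \<zero>"
      using power_independentD(2)[OF L(2) _ _ _ assms(2), of "\<ominus> \<one>"] subringE(3,5)[OF L(1)] by blast
    then show False
      using ix assms(2) by simp
  qed
  have "\<exists>M. subring M R \<and> adjoin R L x \<subseteq> M \<and> inv x \<notin> M \<and>
    (\<forall>B. subring B R \<longrightarrow> M \<subseteq> B \<longrightarrow> inv x \<notin> B \<longrightarrow> B = M)"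
    by (rule exists_maximal_subring_with[where P = "\<lambda>B. inv x \<notin> B", OF adj ixA])
      (auto simp: pred_on.chain_def)
  then obtain M where M: "subring M R" "adjoin R L x \<subseteq> M" "inv x \<notin> M"
    and Mmax: "\<And>B. subring B R \<Longrightarrow> M \<subseteq> B \<Longrightarrow> inv x \<notin> B \<Longrightarrow> B = M"
    by auto
  have xM: "x \<in> M" and LM: "L \<subseteq> M"
    using M(2) adjoin_gen[OF L(1) assms(2)] adjoin_incl[OF L(1) assms(2)] by auto
  note MR = subringE(1)[OF M(1)]
  \<comment> \<open>Each vanishing constant term costs one factor x. Once the constant term d is
    nonzero, the polynomial is d (1 - x r), where d is a unit because L is a field and 1 - x r is
    one by the Jacobson property.\<close>
  have divides: "\<exists>(k::nat) e. e \<in> M \<and> horner R x ds \<otimes> e = x [^] k"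
    if "set ds \<subseteq> L" "\<not> set ds \<subseteq> {\<zero>}" for ds
    using that
  proof (induction ds)
    case (Cons d ds)
    define h where "h = horner R x ds"
    have h: "h \<in> M" "h \<in> carrier R"
      using Cons.prems(1) M(2) MR by (auto simp: adjoin_def h_def)
    show ?case
    proof (cases "d = \<zero>")
      case True
      then obtain k :: nat and e where ke: "e \<in> M" "h \<otimes> e = x [^] k"
        using Cons by (auto simp: h_def)
      have "e \<in> carrier R"
        using ke(1) MR by blast
      then have "horner R x (d # ds) \<otimes> e = x [^] Suc k"
        using True h(2) assms(2) ke(2) by (simp add: h_def[symmetric] m_assoc) (simp add: m_comm)
      then show ?thesis
        using ke(1) by blast
    next
      case False
      have d: "d \<in> L" "d \<in> carrier R"
        using Cons.prems LR by auto
      then have "inv d \<in> L"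
        using maximal_power_independent_inv_closed[OF L(1) assms(2) L(2) Lmax] False by blast
      then have id: "inv d \<in> M" "inv d \<in> carrier R" "d \<otimes> inv d = \<one>"
        using LM MR d(2) False field_Units by auto
      define r where "r = \<ominus> (inv d \<otimes> h)"
      have r: "r \<in> M" "r \<in> carrier R"
        using id h subringE(5,6)[OF M(1)] by (auto simp: r_def)
      define w where "w = \<one> \<ominus> x \<otimes> r"
      have w: "w \<in> carrier R" "w \<noteq> \<zero>" "inv w \<in> M"
        using avoiding_inv_jacobson[OF M(1) xM x0 M(3) Mmax r(1)] r(2) assms(2) by (auto simp: w_def)
      then have iw: "inv w \<in> carrier R" "w \<otimes> inv w = \<one>"
        using field_Units by auto
      have "d \<otimes> w = d \<oplus> (d \<otimes> inv d) \<otimes> (x \<otimes> h)"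
        using d(2) id(2) h(2) assms(2) unfolding w_def r_def by algebra
      then have "horner R x (d # ds) = d \<otimes> w"
        using id(3) h(2) assms(2) d(2) by (simp add: h_def)
      then have "horner R x (d # ds) \<otimes> (inv d \<otimes> inv w) = (d \<otimes> inv d) \<otimes> (w \<otimes> inv w)"
        using d(2) id(2) w(1) iw(1) by (simp add: m_ac)
      then have "horner R x (d # ds) \<otimes> (inv d \<otimes> inv w) = x [^] (0::nat)"
        using id(3) iw(2) by simp
      moreover have "inv d \<otimes> inv w \<in> M"
        using id(1) w(3) subringE(6)[OF M(1)] by blast
      ultimately show ?thesis
        by blast
    qed
  qed simp
  \<comment> \<open>In a relation for y over L[x], multiplication by a suitable e in M turns the
    leading coefficient into x^k. Then x^k y is integral over M, hence in M.\<close>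
  have denominators: "\<exists>k::nat. x [^] k \<otimes> y \<in> M" if y: "y \<in> carrier R" for y
  proof -
    obtain ps where ps: "set ps \<subseteq> adjoin R L x" "horner R y ps = \<zero>" "\<not> set ps \<subseteq> {\<zero>}"
      using maximal_power_independent_algebraic[OF L(1) assms(2) L(2) Lmax y] by blast
    \<comment> \<open>Trailing zero coefficients are dropped until the leading one is
      nonzero.\<close>
    have "\<exists>qs p. set qs \<subseteq> adjoin R L x \<and> p \<in> adjoin R L x \<and> p \<noteq> \<zero> \<and> horner R y (qs @ [p]) = \<zero>"
      using ps
    proof (induction ps rule: rev_induct)
      case (snoc p ps)
      show ?case
      proof (cases "p = \<zero>")
        case True
        have "set ps \<subseteq> carrier R"
          using snoc.prems(1) M(2) MR by auto
        then have "horner R y ps = \<zero>"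
          using snoc.prems(2) True y by (simp add: horner_snoc)
        then show ?thesis
          using snoc True by auto
      next
        case False
        then show ?thesis
          using snoc.prems by (intro exI[of _ ps] exI[of _ p]) auto
      qed
    qed simp
    then obtain qs p where qs: "set qs \<subseteq> adjoin R L x" "p \<in> adjoin R L x" "p \<noteq> \<zero>"
      "horner R y (qs @ [p]) = \<zero>"
      by blast
    obtain ds where ds: "set ds \<subseteq> L" "p = horner R x ds"
      using qs(2) by (auto simp: adjoin_def)
    then have "\<not> set ds \<subseteq> {\<zero>}"
      using qs(3) horner_zeros[OF assms(2)] by blast
    then obtain k :: nat and e where e: "e \<in> M" "p \<otimes> e = x [^] k"
      using divides ds by blast
    have eR: "e \<in> carrier R" "p \<in> carrier R" "set qs \<subseteq> carrier R"
      using e(1) qs(1,2) M(2) MR by auto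
    define rs where "rs = map ((\<otimes>) e) qs"
    have rs: "set rs \<subseteq> M"
      using qs(1) e(1) M(2) subringE(6)[OF M(1)] by (auto simp: rs_def)
    have "horner R y (map ((\<otimes>) e) (qs @ [p])) = \<zero>"
      using eR y qs(4) by (subst horner_map_mult) auto
    moreover have "map ((\<otimes>) e) (qs @ [p]) = rs @ [x [^] k]"
      using e(2) eR by (simp add: rs_def m_comm)
    ultimately have rel: "horner R y (rs @ [x [^] k]) = \<zero>"
      by simp
    have xk: "x [^] k \<in> M" "x [^] k \<in> carrier R" "x [^] k \<noteq> \<zero>"
      using subring_nat_pow_closed[OF M(1) xM] assms(2) x0 Units_pow_closed[of x k]
      by (auto simp: field_Units)
    obtain es where es: "set es \<subseteq> M"
      "(x [^] k) [^] length rs \<otimes> horner R y (rs @ [x [^] k])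
        = x [^] k \<otimes> horner R (x [^] k \<otimes> y) (es @ [\<one>])"
      using horner_make_monic[OF M(1) xk(1) y rs] by blast
    have "horner R (x [^] k \<otimes> y) (es @ [\<one>]) \<in> carrier R"
      using es(1) MR y xk(2) by (auto intro!: horner_closed)
    then have "horner R (x [^] k \<otimes> y) (es @ [\<one>]) = \<zero>"
      using es(2) rel xk integral[of "x [^] k"] by auto
    then have "x [^] k \<otimes> y \<in> M"
      using avoiding_inv_integrally_closed[OF M(1) xM x0 M(3) Mmax _ es(1)] y xk(2) by auto
    then show ?thesis
      by blast
  qed
  show ?thesis
  proof (rule has_maximal_subring_if_finitely_generated[OF M(1), of "{inv x}"])
    show "M \<noteq> carrier R"
      using M(3) ix(1) by blast
    fix B assume B: "subring B R" "M \<subseteq> B" "{inv x} \<subseteq> B"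
    have "y \<in> B" if y: "y \<in> carrier R" for y
    proof -
      obtain k :: nat where k: "x [^] k \<otimes> y \<in> M"
        using denominators y by blast
      have "inv x [^] k \<otimes> (x [^] k \<otimes> y) = (inv x \<otimes> x) [^] k \<otimes> y"
        using ix(1) assms(2) y by (simp add: nat_pow_distrib m_assoc)
      then have "y = inv x [^] k \<otimes> (x [^] k \<otimes> y)"
        using ix(3) y by simp
      moreover have "inv x [^] k \<in> B"
        using subring_nat_pow_closed[OF B(1)] B(3) by blast
      ultimately show ?thesis
        using k B(2) subringE(6)[OF B(1)] by (metis subsetD)
    qed
    then show "B = carrier R"
      using subringE(1)[OF B(1)] by blast
  qed (use ix in auto)
qed

end

section \<open>Simple rings integral over their center\<close>

text \<open>The list form of \<open>integral_over_center\<close>, which homomorphisms transport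
  coefficient by coefficient.\<close>

definition center_integral :: "('a, 'b) ring_scheme \<Rightarrow> bool" where
  "center_integral R \<longleftrightarrow>
    (\<forall>x\<in>carrier R. \<exists>cs. set cs \<subseteq> ring_center R \<and> horner R x (cs @ [\<one>\<^bsub>R\<^esub>]) = \<zero>\<^bsub>R\<^esub>)"

lemma (in ring) center_closed: "ring_center R \<subseteq> carrier R"
  by (auto simp: ring_center_def)

lemma (in ring) finsum_powers_eq_horner:
  assumes "x \<in> carrier R" "c \<in> {..<n} \<rightarrow> ring_center R"
  shows "(\<Oplus>j\<in>{..<n}. c j \<otimes> x [^] j) = horner R x (map c [0..<n])"
  using assms(2)
proof (induction n)
  case (Suc n)
  have c: "c n \<in> carrier R" "c n \<otimes> x [^] n = x [^] n \<otimes> c n" "set (map c [0..<n]) \<subseteq> carrier R"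
    "\<And>j. j < n \<Longrightarrow> c j \<in> carrier R" "c \<in> {..<n} \<rightarrow> ring_center R"
    using Suc.prems assms(1) by (auto simp: ring_center_def Pi_def)
  have "(\<Oplus>j\<in>{..<Suc n}. c j \<otimes> x [^] j) = c n \<otimes> x [^] n \<oplus> (\<Oplus>j\<in>{..<n}. c j \<otimes> x [^] j)"
    unfolding lessThan_Suc using c assms(1) by (intro finsum_insert) auto
  also have "\<dots> = horner R x (map c [0..<Suc n])"
    using Suc c assms(1) by (simp add: horner_snoc a_comm)
  finally show ?case .
qed (simp)

lemma (in ring) center_integral_if_integral_over_center:
  assumes "integral_over_center R"
  shows "center_integral R"
  unfolding center_integral_def
proof
  fix x assume x: "x \<in> carrier R"
  then obtain n :: nat and c where c: "c \<in> {..<n} \<rightarrow> ring_center R"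
    "x [^] n \<oplus> (\<Oplus>j\<in>{..<n}. c j \<otimes> x [^] j) = \<zero>"
    using assms unfolding integral_over_center_def by blast
  have cs: "set (map c [0..<n]) \<subseteq> ring_center R"
    using c(1) by auto
  then have "set (map c [0..<n]) \<subseteq> carrier R"
    using center_closed by blast
  then have "horner R x (map c [0..<n] @ [\<one>]) = \<zero>"
    using c(2) x finsum_powers_eq_horner[OF x c(1)] by (simp add: horner_snoc a_comm)
  with cs show "\<exists>cs. set cs \<subseteq> ring_center R \<and> horner R x (cs @ [\<one>]) = \<zero>"
    by blast
qed

lemma (in ring_hom_ring) hom_horner:
  assumes "x \<in> carrier R" "set cs \<subseteq> carrier R"
  shows "h (horner R x cs) = horner S (h x) (map h cs)"
  using assms(2)
proof (induction cs)
  case (Cons c cs)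
  then show ?case
    using assms(1) by (simp add: R.horner_closed)
qed simp

text \<open>Surjectivity serves both to lift the given element and to make images of central
  elements central.\<close>

lemma (in ring_hom_ring) center_integral_surjective_image:
  assumes "h ` carrier R = carrier S" "center_integral R"
  shows "center_integral S"
  unfolding center_integral_def
proof
  fix y assume "y \<in> carrier S"
  then have "y \<in> h ` carrier R"
    using assms(1) by simp
  then obtain x where x: "x \<in> carrier R" "h x = y"
    by auto
  obtain cs where cs: "set cs \<subseteq> ring_center R" "horner R x (cs @ [\<one>\<^bsub>R\<^esub>]) = \<zero>\<^bsub>R\<^esub>"
    using assms(2) x(1) by (auto simp: center_integral_def)
  have csR: "set cs \<subseteq> carrier R"
    using cs(1) R.center_closed by blast
  have "h c \<in> ring_center S" if c: "c \<in> ring_center R" for c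
  proof -
    have cR: "c \<in> carrier R"
      using c R.center_closed by blast
    have "h c \<otimes>\<^bsub>S\<^esub> s = s \<otimes>\<^bsub>S\<^esub> h c" if s: "s \<in> carrier S" for s
    proof -
      have "s \<in> h ` carrier R"
        using s assms(1) by simp
      then obtain r where r: "r \<in> carrier R" "s = h r"
        by auto
      then have "c \<otimes>\<^bsub>R\<^esub> r = r \<otimes>\<^bsub>R\<^esub> c"
        using c by (auto simp: ring_center_def)
      then show ?thesis
        using r cR by (metis hom_mult)
    qed
    then show ?thesis
      using cR by (auto simp: ring_center_def)
  qed
  then have "set (map h cs) \<subseteq> ring_center S"
    using cs(1) by auto
  moreover have "horner S y (map h cs @ [\<one>\<^bsub>S\<^esub>]) = \<zero>\<^bsub>S\<^esub>"
    using hom_horner[OF x(1), of "cs @ [\<one>\<^bsub>R\<^esub>]"] csR cs(2) x(2) by simp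
  ultimately show "\<exists>cs. set cs \<subseteq> ring_center S \<and> horner S y (cs @ [\<one>\<^bsub>S\<^esub>]) = \<zero>\<^bsub>S\<^esub>"
    by blast
qed

text \<open>The operator s \<mapsto> sum of u s v over the listed pairs (u, v), an element of the
  multiplication algebra. Its values at b form the two-sided ideal generated by b, so simplicity
  says that every nonzero b can be sent to 1.\<close>

primrec mulop :: "('a, 'b) ring_scheme \<Rightarrow> ('a \<times> 'a) list \<Rightarrow> 'a \<Rightarrow> 'a" where
  "mulop R [] s = \<zero>\<^bsub>R\<^esub>"
| "mulop R (p # ps) s = fst p \<otimes>\<^bsub>R\<^esub> s \<otimes>\<^bsub>R\<^esub> snd p \<oplus>\<^bsub>R\<^esub> mulop R ps s"

text \<open>Let \<open>a\<close> be a root of the monic polynomial \<open>p\<close> with central coefficients \<open>cs\<close> and top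
  coefficient one, and write \<open>p(t) = (t - a) (h\<^sub>0 + h\<^sub>1 t + \<dots>)\<close>. Then \<open>centralize\<close> sends \<open>s\<close> to
  the sum of the \<open>h\<^sub>j s a\<^sup>j\<close>, which commutes with \<open>a\<close>; \<open>recombine\<close> recovers \<open>s\<close> from such elements.\<close>

primrec centralize :: "('a, 'b) ring_scheme \<Rightarrow> 'a \<Rightarrow> 'a list \<Rightarrow> 'a \<Rightarrow> 'a" where
  "centralize R a [] s = \<zero>\<^bsub>R\<^esub>"
| "centralize R a (c # cs) s =
    horner R a (cs @ [\<one>\<^bsub>R\<^esub>]) \<otimes>\<^bsub>R\<^esub> s \<oplus>\<^bsub>R\<^esub> centralize R a cs s \<otimes>\<^bsub>R\<^esub> a"

primrec recombine :: "('a, 'b) ring_scheme \<Rightarrow> 'a \<Rightarrow> 'a list \<Rightarrow> ('a \<times> 'a) list \<Rightarrow> 'a \<Rightarrow> 'a" where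
  "recombine R a cs [] s = \<zero>\<^bsub>R\<^esub>"
| "recombine R a cs (p # ps) s =
    centralize R a cs (s \<otimes>\<^bsub>R\<^esub> fst p) \<otimes>\<^bsub>R\<^esub> snd p \<oplus>\<^bsub>R\<^esub> recombine R a cs ps s"

context ring
begin

abbreviation "pairs \<equiv> carrier R \<times> carrier R"

lemma mulop_closed [simp]:
  "set ps \<subseteq> pairs \<Longrightarrow> s \<in> carrier R \<Longrightarrow> mulop R ps s \<in> carrier R"
  by (induction ps) auto

lemma mulop_append:
  assumes "set ps \<subseteq> pairs" "set qs \<subseteq> pairs" "s \<in> carrier R"
  shows "mulop R (ps @ qs) s = mulop R ps s \<oplus> mulop R qs s"
  using assms by (induction ps) (auto simp: a_assoc)

lemma mulop_zero: "set ps \<subseteq> pairs \<Longrightarrow> mulop R ps \<zero> = \<zero>"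
  by (induction ps) auto

lemma mulop_left:
  assumes "set ps \<subseteq> pairs" "s \<in> carrier R" "c \<in> carrier R"
  shows "mulop R (map (\<lambda>p. (c \<otimes> fst p, snd p)) ps) s = c \<otimes> mulop R ps s"
  using assms by (induction ps) (auto simp: m_assoc r_distr)

lemma mulop_right:
  assumes "set ps \<subseteq> pairs" "s \<in> carrier R" "c \<in> carrier R"
  shows "mulop R (map (\<lambda>p. (fst p, snd p \<otimes> c)) ps) s = mulop R ps s \<otimes> c"
  using assms by (induction ps) (auto simp: m_assoc l_distr)

lemma mulop_shift:
  assumes "set ps \<subseteq> pairs" "s \<in> carrier R" "c \<in> carrier R"
  shows "mulop R (map (\<lambda>p. (fst p, c \<otimes> snd p)) ps) s = mulop R ps (s \<otimes> c)"
  using assms by (induction ps) (auto simp: m_assoc)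

lemma mulop_compose:
  assumes "set ps \<subseteq> pairs" "set qs \<subseteq> pairs"
  shows "\<exists>rs. set rs \<subseteq> pairs \<and> (\<forall>s\<in>carrier R. mulop R rs s = mulop R qs (mulop R ps s))"
  using assms(2)
proof (induction qs)
  case Nil
  show ?case
    by (intro exI[of _ "[]"]) simp
next
  case (Cons q qs)
  then obtain rs where rs: "set rs \<subseteq> pairs" "\<forall>s\<in>carrier R. mulop R rs s = mulop R qs (mulop R ps s)"
    by auto
  let ?ls = "map (\<lambda>p. (fst q \<otimes> fst p, snd p)) ps"
  let ?ts = "map (\<lambda>p. (fst p, snd p \<otimes> snd q)) ?ls"
  have q: "fst q \<in> carrier R" "snd q \<in> carrier R"
    using Cons.prems by auto
  then have ls: "set ?ls \<subseteq> pairs"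
    using assms(1) by auto
  then have ts: "set ?ts \<subseteq> pairs"
    using q by auto
  have "mulop R (?ts @ rs) s = mulop R (q # qs) (mulop R ps s)" if s: "s \<in> carrier R" for s
    using mulop_append[OF ts rs(1) s] mulop_right[OF ls s q(2)] mulop_left[OF assms(1) s q(1)]
      rs(2) s by simp
  then show ?case
    using ts rs(1) by (intro exI[of _ "?ts @ rs"]) simp
qed

text \<open>Evaluates the correction term of the operator s - sum of a^i u_i(s) at a power of
  \<open>a\<close>, for operators u_i dual to those powers.\<close>

lemma horner_Kronecker:
  assumes "a \<in> carrier R"
  shows "horner R a (map (\<lambda>i. \<ominus> (if i = j then \<one> else \<zero>)) [0..<k]) = (if j < k then \<ominus> (a [^] j) else \<zero>)"
proof (induction k)
  case (Suc k)
  have "set (map (\<lambda>i. \<ominus> (if i = j then \<one> else \<zero>)) [0..<k]) \<subseteq> carrier R"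
    by auto
  then show ?case
    using Suc assms by (auto simp: horner_snoc r_minus less_Suc_eq)
qed simp

text \<open>A multiplication operator annihilating \<open>a ^ j\<close> for all \<open>j < m\<close> but not \<open>a ^ m\<close> must exist:
  otherwise the values \<open>z i\<close> of the dual operators at \<open>a ^ m\<close> would be central and
  \<open>a ^ m\<close> would be their combination, against the minimality of the degree.\<close>

lemma separating_mulop:
  assumes a: "a \<in> carrier R"
    and indep: "\<And>cs. set cs \<subseteq> ring_center R \<Longrightarrow> length cs = m \<Longrightarrow> horner R a (cs @ [\<one>]) \<noteq> \<zero>"
    and us: "\<And>i. i < m \<Longrightarrow> set (us i) \<subseteq> pairs"
    and dual: "\<And>i j. i < m \<Longrightarrow> j < m \<Longrightarrow> mulop R (us i) (a [^] j) = (if i = j then \<one> else \<zero>)"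
  shows "\<exists>ps. set ps \<subseteq> pairs \<and> (\<forall>j<m. mulop R ps (a [^] j) = \<zero>) \<and> mulop R ps (a [^] m) \<noteq> \<zero>"
proof (rule ccontr)
  assume "\<not> ?thesis"
  then have kill: "mulop R ps (a [^] m) = \<zero>"
    if "set ps \<subseteq> pairs" "\<And>j. j < m \<Longrightarrow> mulop R ps (a [^] j) = \<zero>" for ps
    using that by blast
  define z where "z i = mulop R (us i) (a [^] m)" for i
  have z: "z i \<in> carrier R" if "i < m" for i
    using us[OF that] a by (simp add: z_def)
  have central: "z i \<in> ring_center R" if i: "i < m" for i
  proof -
    have "z i \<otimes> t = t \<otimes> z i" if t: "t \<in> carrier R" for t
    proof -
      \<comment> \<open>Together these give the operator s \<mapsto> t u_i(s) - u_i(s) t. It kills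
        every a^j with j < m, where u_i takes the central values 0 and 1, and therefore also
        a^m.\<close>
      let ?ls = "map (\<lambda>p. (t \<otimes> fst p, snd p)) (us i)"
      let ?rs = "map (\<lambda>p. (fst p, snd p \<otimes> \<ominus> t)) (us i)"
      have ls: "set ?ls \<subseteq> pairs" and rs: "set ?rs \<subseteq> pairs"
        using us[OF i] t by auto
      have val: "mulop R (?ls @ ?rs) s = t \<otimes> mulop R (us i) s \<oplus> mulop R (us i) s \<otimes> \<ominus> t"
        if s: "s \<in> carrier R" for s
        using mulop_append[OF ls rs s] mulop_left[OF us[OF i] s t]
          mulop_right[OF us[OF i] s a_inv_closed[OF t]] by simp
      have "mulop R (?ls @ ?rs) (a [^] m) = \<zero>"
      proof (rule kill)
        show "set (?ls @ ?rs) \<subseteq> pairs"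
          using ls rs by simp
        show "mulop R (?ls @ ?rs) (a [^] j) = \<zero>" if "j < m" for j
          using val[of "a [^] j"] a t dual[OF i that] by (auto simp: r_neg)
      qed
      then have "t \<otimes> z i \<oplus> \<ominus> (z i \<otimes> t) = \<zero>"
        using val[of "a [^] m"] a t z[OF i] by (simp add: z_def[symmetric] r_minus)
      then show ?thesis
        using t z[OF i] by (metis m_closed minus_equality minus_minus a_inv_closed a_comm)
    qed
    then show ?thesis
      using z[OF i] by (auto simp: ring_center_def)
  qed
  \<comment> \<open>The operator s - sum of a^i u_i(s) over i < k, built one index at a time. For k
    = m it kills the lower powers, hence a^m, which expresses a^m through the central values
    z_i.\<close>
  have "\<exists>ps. set ps \<subseteq> pairs \<and> (\<forall>s\<in>carrier R. mulop R ps s =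
    s \<oplus> horner R a (map (\<lambda>i. \<ominus> mulop R (us i) s) [0..<k]))" if "k \<le> m" for k
    using that
  proof (induction k)
    case 0
    show ?case
      by (intro exI[of _ "[(\<one>, \<one>)]"]) auto
  next
    case (Suc k)
    then obtain ps where ps: "set ps \<subseteq> pairs" "\<forall>s\<in>carrier R. mulop R ps s =
      s \<oplus> horner R a (map (\<lambda>i. \<ominus> mulop R (us i) s) [0..<k])"
      by auto
    have uk: "set (us k) \<subseteq> pairs"
      using us Suc.prems by simp
    let ?qs = "map (\<lambda>p. (\<ominus> (a [^] k) \<otimes> fst p, snd p)) (us k)"
    have qs: "set ?qs \<subseteq> pairs"
      using uk a by auto
    have "mulop R (ps @ ?qs) s = s \<oplus> horner R a (map (\<lambda>i. \<ominus> mulop R (us i) s) [0..<Suc k])"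
      if s: "s \<in> carrier R" for s
    proof -
      have set: "set (map (\<lambda>i. \<ominus> mulop R (us i) s) [0..<k]) \<subseteq> carrier R"
        using us Suc.prems s by auto
      have "mulop R (ps @ ?qs) s = mulop R ps s \<oplus> \<ominus> (a [^] k) \<otimes> mulop R (us k) s"
        using mulop_append[OF ps(1) qs s] mulop_left[OF uk s] a by simp
      then show ?thesis
        using ps(2) s set a mulop_closed[OF uk s] by (simp add: horner_snoc a_assoc l_minus r_minus)
    qed
    then show ?case
      using ps(1) qs by (intro exI[of _ "ps @ ?qs"]) simp
  qed
  then obtain ps where ps: "set ps \<subseteq> pairs" "\<And>s. s \<in> carrier R \<Longrightarrow> mulop R ps s =
    s \<oplus> horner R a (map (\<lambda>i. \<ominus> mulop R (us i) s) [0..<m])"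
    by blast
  have "mulop R ps (a [^] m) = \<zero>"
  proof (rule kill[OF ps(1)])
    fix j assume j: "j < m"
    have eq: "map (\<lambda>i. \<ominus> mulop R (us i) (a [^] j)) [0..<m] = map (\<lambda>i. \<ominus> (if i = j then \<one> else \<zero>)) [0..<m]"
      using dual j by (intro map_cong) auto
    show "mulop R ps (a [^] j) = \<zero>"
      using ps(2)[of "a [^] j", unfolded eq horner_Kronecker[OF a]] a j by (simp add: r_neg)
  qed
  then have "a [^] m \<oplus> horner R a (map (\<lambda>i. \<ominus> z i) [0..<m]) = \<zero>"
    using ps(2)[of "a [^] m"] a by (simp add: z_def)
  moreover have mz: "set (map (\<lambda>i. \<ominus> z i) [0..<m]) \<subseteq> ring_center R"
    using central by (auto simp: ring_center_def l_minus r_minus)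
  moreover have "set (map (\<lambda>i. \<ominus> z i) [0..<m]) \<subseteq> carrier R"
    using z by auto
  ultimately have "horner R a (map (\<lambda>i. \<ominus> z i) [0..<m] @ [\<one>]) = \<zero>"
    using a by (simp add: horner_snoc a_comm)
  with indep[OF mz] show False
    by simp
qed

text \<open>A Gram-Schmidt argument: a separating operator is normalized by simplicity to take the
  value 1 at a^m and becomes the new dual operator; each old one is corrected by a left multiple of
  it to vanish at a^m.\<close>

lemma dual_mulops:
  assumes a: "a \<in> carrier R"
    and simple: "\<And>b. b \<in> carrier R \<Longrightarrow> b \<noteq> \<zero> \<Longrightarrow> \<exists>ps. set ps \<subseteq> pairs \<and> mulop R ps b = \<one>"
    and indep: "\<And>cs. set cs \<subseteq> ring_center R \<Longrightarrow> length cs < n \<Longrightarrow> horner R a (cs @ [\<one>]) \<noteq> \<zero>"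
  shows "m \<le> n \<Longrightarrow> \<exists>us. \<forall>i<m. set (us i) \<subseteq> pairs \<and>
    (\<forall>j<m. mulop R (us i) (a [^] j) = (if i = j then \<one> else \<zero>))"
proof (induction m)
  case (Suc m)
  then obtain us where us: "\<And>i. i < m \<Longrightarrow> set (us i) \<subseteq> pairs"
    "\<And>i j. i < m \<Longrightarrow> j < m \<Longrightarrow> mulop R (us i) (a [^] j) = (if i = j then \<one> else \<zero>)"
    by auto
  obtain ps where ps: "set ps \<subseteq> pairs" "\<forall>j<m. mulop R ps (a [^] j) = \<zero>" "mulop R ps (a [^] m) \<noteq> \<zero>"
  proof -
    have "\<exists>ps. set ps \<subseteq> pairs \<and> (\<forall>j<m. mulop R ps (a [^] j) = \<zero>) \<and> mulop R ps (a [^] m) \<noteq> \<zero>"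
      by (rule separating_mulop[OF a _ us]) (use indep Suc.prems in auto)
    then show ?thesis
      using that by auto
  qed
  obtain qs where qs: "set qs \<subseteq> pairs" "mulop R qs (mulop R ps (a [^] m)) = \<one>"
    using simple[OF _ ps(3)] ps(1) a by auto
  obtain rs where rs: "set rs \<subseteq> pairs" "\<forall>s\<in>carrier R. mulop R rs s = mulop R qs (mulop R ps s)"
    using mulop_compose[OF ps(1) qs(1)] by auto
  have r: "mulop R rs (a [^] j) = (if j = m then \<one> else \<zero>)" if "j < Suc m" for j
    using that rs(2) a ps(2) qs mulop_zero[OF qs(1)] by (auto simp: less_Suc_eq)
  define vs where "vs i = (if i = m then rs
    else us i @ map (\<lambda>p. (\<ominus> mulop R (us i) (a [^] m) \<otimes> fst p, snd p)) rs)" for i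
  have "set (vs i) \<subseteq> pairs \<and> (\<forall>j<Suc m. mulop R (vs i) (a [^] j) = (if i = j then \<one> else \<zero>))"
    if i: "i < Suc m" for i
  proof (cases "i = m")
    case True
    then show ?thesis
      using r rs(1) by (auto simp: vs_def)
  next
    case False
    then have im: "i < m"
      using i by simp
    have z: "\<ominus> mulop R (us i) (a [^] m) \<in> carrier R"
      using us(1)[OF im] a by simp
    let ?ts = "map (\<lambda>p. (\<ominus> mulop R (us i) (a [^] m) \<otimes> fst p, snd p)) rs"
    have ts: "set ?ts \<subseteq> pairs"
      using rs(1) z by auto
    have "mulop R (us i @ ?ts) (a [^] j) = (if i = j then \<one> else \<zero>)" if j: "j < Suc m" for j
      using mulop_append[OF us(1)[OF im] ts, of "a [^] j"] mulop_left[OF rs(1) _ z, of "a [^] j"]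
        a r[OF j] us(1)[OF im] us(2)[OF im] z im j by (auto simp: less_Suc_eq r_neg)
    then show ?thesis
      using False us(1)[OF im] ts by (auto simp: vs_def)
  qed
  then show ?case
    by blast
qed auto

lemma horner_commute:
  assumes "a \<in> carrier R" "set cs \<subseteq> ring_center R"
  shows "horner R a cs \<otimes> a = a \<otimes> horner R a cs"
  using assms(2)
proof (induction cs)
  case (Cons c cs)
  then have "set cs \<subseteq> carrier R" "c \<in> carrier R" "c \<otimes> a = a \<otimes> c"
    using assms(1) by (auto simp: ring_center_def)
  then show ?case
    using Cons assms(1) by (simp add: l_distr r_distr m_assoc)
qed (use assms in simp)

lemma one_in_center: "\<one> \<in> ring_center R"
  by (simp add: ring_center_def)

lemma centralize_closed [simp]:
  assumes "a \<in> carrier R" "set cs \<subseteq> carrier R" "s \<in> carrier R"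
  shows "centralize R a cs s \<in> carrier R"
  using assms(2) by (induction cs) (use assms(1,3) in auto)

text \<open>Writing T for \<open>centralize\<close> and p for the monic polynomial, this is a T(s) -
  T(s) a = p(a) s - s p(a) without subtraction. At a root of p the right side vanishes and T(s)
  commutes with \<open>a\<close>.\<close>

lemma centralize_commute:
  assumes a: "a \<in> carrier R" and s: "s \<in> carrier R" and "set cs \<subseteq> ring_center R"
  shows "a \<otimes> centralize R a cs s \<oplus> s \<otimes> horner R a (cs @ [\<one>])
    = centralize R a cs s \<otimes> a \<oplus> horner R a (cs @ [\<one>]) \<otimes> s"
  using assms(3)
proof (induction cs)
  case (Cons c cs)
  define t where "t = centralize R a cs s"
  define h where "h = horner R a (cs @ [\<one>])"
  have csR: "set cs \<subseteq> carrier R" "c \<in> carrier R"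
    using Cons.prems center_closed by auto
  have th: "t \<in> carrier R" "h \<in> carrier R"
    using csR a s by (auto simp: t_def h_def)
  have c: "s \<otimes> c = c \<otimes> s"
    using Cons.prems s by (auto simp: ring_center_def)
  have ha: "h \<otimes> a = a \<otimes> h"
    unfolding h_def using Cons.prems a one_in_center by (intro horner_commute) auto
  have "(a \<otimes> t \<oplus> s \<otimes> h) \<otimes> a = (t \<otimes> a \<oplus> h \<otimes> s) \<otimes> a"
    using Cons by (simp add: t_def h_def)
  then have IH: "a \<otimes> t \<otimes> a \<oplus> s \<otimes> (a \<otimes> h) = t \<otimes> a \<otimes> a \<oplus> h \<otimes> s \<otimes> a"
    using th a s ha by (simp add: l_distr m_assoc)
  have "a \<otimes> (h \<otimes> s \<oplus> t \<otimes> a) \<oplus> s \<otimes> (c \<oplus> a \<otimes> h)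
    = (a \<otimes> t \<otimes> a \<oplus> s \<otimes> (a \<otimes> h)) \<oplus> (c \<otimes> s \<oplus> a \<otimes> h \<otimes> s)"
    using th a s csR c by (simp add: r_distr m_assoc a_ac)
  also have "\<dots> = (h \<otimes> s \<oplus> t \<otimes> a) \<otimes> a \<oplus> (c \<oplus> a \<otimes> h) \<otimes> s"
    unfolding IH using th a s csR by (simp add: l_distr m_assoc a_ac)
  finally show ?case
    by (simp add: t_def h_def)
qed (use assms in simp)

lemma recombine_closed:
  assumes "a \<in> carrier R" "set cs \<subseteq> carrier R" "s \<in> carrier R" "set ps \<subseteq> pairs"
  shows "recombine R a cs ps s \<in> carrier R"
  using assms(4) by (induction ps) (use assms(1-3) in auto)

text \<open>Splits off the summand h_0 s belonging to a^0; in the others one factor \<open>a\<close>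
  moves into the right components of the pairs.\<close>

lemma recombine_Cons:
  assumes "a \<in> carrier R" "set (c # cs) \<subseteq> carrier R" "s \<in> carrier R" "set ps \<subseteq> pairs"
  shows "recombine R a (c # cs) ps s = horner R a (cs @ [\<one>]) \<otimes> s \<otimes> mulop R ps \<one>
    \<oplus> recombine R a cs (map (\<lambda>p. (fst p, a \<otimes> snd p)) ps) s"
  using assms(4)
proof (induction ps)
  case Nil
  then show ?case
    using assms by simp
next
  case (Cons p ps)
  define h where "h = horner R a (cs @ [\<one>])"
  define t where "t = centralize R a cs (s \<otimes> fst p)"
  define g where "g = recombine R a cs (map (\<lambda>p. (fst p, a \<otimes> snd p)) ps) s"
  define m where "m = mulop R ps \<one>"
  have p: "fst p \<in> carrier R" "snd p \<in> carrier R"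
    using Cons.prems by auto
  have R: "h \<in> carrier R" "t \<in> carrier R" "m \<in> carrier R"
    using assms p Cons.prems by (auto simp: h_def t_def m_def)
  have "set (map (\<lambda>p. (fst p, a \<otimes> snd p)) ps) \<subseteq> pairs"
    using Cons.prems assms(1) by auto
  then have g: "g \<in> carrier R"
    unfolding g_def using assms by (intro recombine_closed) auto
  have "recombine R a (c # cs) ps s = h \<otimes> s \<otimes> m \<oplus> g"
    using Cons by (simp add: h_def m_def g_def)
  then have "recombine R a (c # cs) (p # ps) s
    = (h \<otimes> (s \<otimes> fst p) \<oplus> t \<otimes> a) \<otimes> snd p \<oplus> (h \<otimes> s \<otimes> m \<oplus> g)"
    by (simp add: h_def t_def)
  also have "\<dots> = h \<otimes> s \<otimes> (fst p \<otimes> \<one> \<otimes> snd p \<oplus> m) \<oplus> (t \<otimes> (a \<otimes> snd p) \<oplus> g)"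
    using R g p assms(1,3) by (simp add: l_distr r_distr m_assoc a_ac)
  finally show ?case
    by (simp add: h_def t_def m_def g_def)
qed

text \<open>Exchanging the two sums gives the sum of h_j s P(a^j), where P is the operator of
  \<open>ps\<close>. Only the top j survives, and there h_j = 1 because the polynomial is
  monic.\<close>

lemma recombine_eq:
  assumes a: "a \<in> carrier R" and s: "s \<in> carrier R"
  shows "set (c # cs) \<subseteq> carrier R \<Longrightarrow> set ps \<subseteq> pairs \<Longrightarrow>
    (\<And>j. j < length cs \<Longrightarrow> mulop R ps (a [^] j) = \<zero>) \<Longrightarrow> mulop R ps (a [^] length cs) = \<one> \<Longrightarrow>
    recombine R a (c # cs) ps s = s"
proof (induction cs arbitrary: c ps)
  case Nil
  have "recombine R a [] qs s = \<zero>" if "set qs \<subseteq> pairs" for qs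
    using that by (induction qs) auto
  moreover have "set (map (\<lambda>p. (fst p, a \<otimes> snd p)) ps) \<subseteq> pairs"
    using Nil a by auto
  ultimately show ?case
    using recombine_Cons[OF a Nil.prems(1) s Nil.prems(2)] Nil s a by simp
next
  case (Cons d cs)
  let ?qs = "map (\<lambda>p. (fst p, a \<otimes> snd p)) ps"
  have qs: "set ?qs \<subseteq> pairs"
    using Cons.prems(2) a by auto
  have val: "mulop R ?qs (a [^] j) = mulop R ps (a [^] Suc j)" for j :: nat
    using mulop_shift[OF Cons.prems(2) _ a, of "a [^] j"] a by simp
  have "recombine R a (d # cs) ?qs s = s"
  proof (rule Cons.IH[OF _ qs])
    show "mulop R ?qs (a [^] j) = \<zero>" if "j < length cs" for j
      using Cons.prems(3)[of "Suc j"] that unfolding val by simp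
    show "mulop R ?qs (a [^] length cs) = \<one>"
      using Cons.prems(4) unfolding val by simp
  qed (use Cons.prems(1) in simp)
  moreover have "mulop R ps \<one> = \<zero>"
    using Cons.prems(3)[of 0] by simp
  ultimately show ?case
    using recombine_Cons[OF a Cons.prems(1) s Cons.prems(2)] s a Cons.prems(1) by simp
qed

text \<open>Each s equals the sum of T(s u) v over the pairs of a fixed operator, where the values
  of T = \<open>centralize\<close> commute with \<open>a\<close>. Hence the finitely many v generate
  the ring over the centralizer, which is proper as \<open>a\<close> is not central.\<close>

theorem has_maximal_subring_if_simple_noncommutative:
  assumes simple: "\<And>b. b \<in> carrier R \<Longrightarrow> b \<noteq> \<zero> \<Longrightarrow> \<exists>ps. set ps \<subseteq> pairs \<and> mulop R ps b = \<one>"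
    and "\<one> \<noteq> \<zero>" "center_integral R"
    and a: "a \<in> carrier R" "a \<notin> ring_center R"
  shows "has_maximal_subring R"
proof -
  define Q where "Q n \<longleftrightarrow> (\<exists>cs. length cs = n \<and> set cs \<subseteq> ring_center R \<and> horner R a (cs @ [\<one>]) = \<zero>)" for n
  have "\<exists>n. Q n"
    using assms(3) a(1) by (auto simp: center_integral_def Q_def)
  then obtain n where n: "Q n" "\<And>m. m < n \<Longrightarrow> \<not> Q m"
    using exists_least_iff[of Q] by blast
  obtain cs where cs: "length cs = n" "set cs \<subseteq> ring_center R" "horner R a (cs @ [\<one>]) = \<zero>"
    using n(1) by (auto simp: Q_def)
  obtain d ds where ds: "cs = d # ds"
    using cs(3) assms(2) a(1) by (cases cs) auto
  have csR: "set cs \<subseteq> carrier R"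
    using cs(2) center_closed by blast
  have "\<exists>us. \<forall>i<n. set (us i) \<subseteq> pairs \<and>
    (\<forall>j<n. mulop R (us i) (a [^] j) = (if i = j then \<one> else \<zero>))"
    by (rule dual_mulops[OF a(1) simple _ order_refl]) (use n(2) in \<open>auto simp: Q_def\<close>)
  then obtain us where us: "\<And>i. i < n \<Longrightarrow> set (us i) \<subseteq> pairs"
    "\<And>i j. i < n \<Longrightarrow> j < n \<Longrightarrow> mulop R (us i) (a [^] j) = (if i = j then \<one> else \<zero>)"
    by metis
  \<comment> \<open>Here \<open>length ds\<close> is n - 1, so this is the operator dual to the
    highest of the powers below the degree n.\<close>
  define ps where "ps = us (length ds)"
  have len: "length ds < n"
    using cs(1) ds by simp
  have ps: "set ps \<subseteq> pairs"
    using us(1)[OF len] by (simp add: ps_def)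
  have rec: "recombine R a cs ps s = s" if s: "s \<in> carrier R" for s
    unfolding ds by (rule recombine_eq[OF a(1) s]) (use csR ds ps us(2)[OF len] len in \<open>auto simp: ps_def\<close>)
  define C where "C = {s \<in> carrier R. a \<otimes> s = s \<otimes> a}"
  have C: "subring C R"
  proof (rule subringI)
    fix s t assume "s \<in> C" "t \<in> C"
    then have st: "s \<in> carrier R" "t \<in> carrier R" "a \<otimes> s = s \<otimes> a" "a \<otimes> t = t \<otimes> a"
      by (auto simp: C_def)
    then have "a \<otimes> (s \<otimes> t) = (s \<otimes> t) \<otimes> a"
      using a(1) by (metis m_assoc)
    then show "s \<otimes> t \<in> C" "s \<oplus> t \<in> C"
      using st a(1) by (auto simp: C_def l_distr r_distr)
  qed (use a in \<open>auto simp: C_def l_minus r_minus\<close>)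
  have central: "centralize R a cs s \<in> C" if s: "s \<in> carrier R" for s
    using centralize_commute[OF a(1) s cs(2)] cs(3) s a(1) csR by (simp add: C_def)
  show ?thesis
  proof (rule has_maximal_subring_if_finitely_generated[OF C, of "snd ` set ps"])
    show "C \<noteq> carrier R"
      using a by (auto simp: C_def ring_center_def)
    show "snd ` set ps \<subseteq> carrier R"
      using ps by auto
    fix B assume B: "subring B R" "C \<subseteq> B" "snd ` set ps \<subseteq> B"
    have "recombine R a cs qs s \<in> B" if "set qs \<subseteq> set ps" "s \<in> carrier R" for qs s
      using that(1)
    proof (induction qs)
      case (Cons q qs)
      then have "fst q \<in> carrier R" "snd q \<in> B"
        using ps B(3) by auto
      then have "centralize R a cs (s \<otimes> fst q) \<otimes> snd q \<in> B"
        using central[of "s \<otimes> fst q"] that(2) B(2) subringE(6)[OF B(1)] by auto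
      then show ?case
        using Cons subringE(7)[OF B(1)] by simp
    qed (use subringE(2)[OF B(1)] in simp)
    then show "B = carrier R"
      using rec subringE(1)[OF B(1)] by (metis order_refl subsetI subset_antisym)
  qed simp
qed

end

section \<open>Quotients by maximal two-sided ideals\<close>

lemma (in ring) idealI':
  assumes "I \<subseteq> carrier R" "\<zero> \<in> I" "\<And>x y. x \<in> I \<Longrightarrow> y \<in> I \<Longrightarrow> x \<oplus> y \<in> I"
    and "\<And>a x. a \<in> carrier R \<Longrightarrow> x \<in> I \<Longrightarrow> a \<otimes> x \<in> I"
    and "\<And>a x. a \<in> carrier R \<Longrightarrow> x \<in> I \<Longrightarrow> x \<otimes> a \<in> I"
  shows "ideal I R"
proof (rule idealI)
  have "\<ominus> x \<in> I" if "x \<in> I" for x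
    using assms(4)[of "\<ominus> \<one>" x] that assms(1) by (auto simp: l_minus)
  then show "subgroup I (add_monoid R)"
    using assms(1-3) by (intro add.subgroupI) (auto simp: a_inv_def)
qed (use assms ring_axioms in auto)

lemma (in ring) ideal_Union_chain:
  assumes "C \<noteq> {}" "subset.chain {I. ideal I R \<and> Q I} C"
  shows "ideal (\<Union>C) R"
proof -
  have id: "ideal I R" if "I \<in> C" for I
    using assms(2) that by (auto simp: pred_on.chain_def)
  have sub: "I \<subseteq> carrier R" "\<zero> \<in> I" if "I \<in> C" for I
    using id[OF that] by (auto dest: ideal.Icarr additive_subgroup.zero_closed[OF ideal.axioms(1)])
  show ?thesis
  proof (rule idealI')
    show "\<Union>C \<subseteq> carrier R" "\<zero> \<in> \<Union>C"
      using sub assms(1) by blast+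
  next
    fix x y assume "x \<in> \<Union>C" "y \<in> \<Union>C"
    then obtain I where "I \<in> C" "x \<in> I" "y \<in> I"
      using finite_subset_Union_chain[OF _ _ assms, of "{x, y}"] by auto
    then show "x \<oplus> y \<in> \<Union>C"
      using additive_subgroup.a_closed[OF ideal.axioms(1)[OF id]] by (metis UnionI)
  next
    fix a x assume "a \<in> carrier R" "x \<in> \<Union>C"
    then show "a \<otimes> x \<in> \<Union>C" "x \<otimes> a \<in> \<Union>C"
      using ideal.I_l_closed[OF id] ideal.I_r_closed[OF id] by (metis UnionE UnionI)+
  qed
qed

lemma (in ring) exists_maximalideal:
  assumes "ideal J R" "\<one> \<notin> J"
  shows "\<exists>M. maximalideal M R \<and> J \<subseteq> M"
proof -
  let ?F = "{I. ideal I R \<and> J \<subseteq> I \<and> \<one> \<notin> I}"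
  have "\<exists>M\<in>?F. \<forall>I\<in>?F. M \<subseteq> I \<longrightarrow> I = M"
  proof (rule subset_Zorn_nonempty)
    fix C assume C: "C \<noteq> {}" "subset.chain ?F C"
    then have "J \<subseteq> \<Union>C" "\<one> \<notin> \<Union>C"
      unfolding pred_on.chain_def by blast+
    then show "\<Union>C \<in> ?F"
      using ideal_Union_chain[OF C] by simp
  qed (use assms in auto)
  then obtain M where M: "ideal M R" "J \<subseteq> M" "\<one> \<notin> M"
    "\<And>I. ideal I R \<Longrightarrow> J \<subseteq> I \<Longrightarrow> \<one> \<notin> I \<Longrightarrow> M \<subseteq> I \<Longrightarrow> I = M"
    by fastforce
  have "maximalideal M R"
  proof (rule maximalidealI[OF M(1)])
    show "carrier R \<noteq> M"
      using M(3) by blast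
    show "I = M \<or> I = carrier R" if "ideal I R" "M \<subseteq> I" for I
      using M(2,4) that ideal.one_imp_carrier[OF that(1)] by blast
  qed
  with M(2) show ?thesis
    by blast
qed

context ideal
begin

lemma quotient_surj: "(+>) I ` carrier R = carrier (R Quot I)"
  by (auto simp: FactRing_def A_RCOSETS_def')

lemma quotient_zero_iff:
  assumes "x \<in> carrier R"
  shows "I +> x = \<zero>\<^bsub>R Quot I\<^esub> \<longleftrightarrow> x \<in> I"
  using assms a_rcos_const a_rcos_self by (auto simp: FactRing_def)

end

text \<open>For a preimage x of b, the sums of u x v plus elements of \<open>I\<close> form a
  two-sided ideal strictly above \<open>I\<close>, hence the whole ring. Reducing such an expression
  of 1 modulo \<open>I\<close> gives the operator.\<close>

lemma (in maximalideal) mulop_quotient_simple: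
  assumes "b \<in> carrier (R Quot I)" "b \<noteq> \<zero>\<^bsub>R Quot I\<^esub>"
  shows "\<exists>ps. set ps \<subseteq> carrier (R Quot I) \<times> carrier (R Quot I) \<and> mulop (R Quot I) ps b = \<one>\<^bsub>R Quot I\<^esub>"
proof -
  interpret h: ring_hom_ring R "R Quot I" "(+>) I"
    by (rule rcos_ring_hom_ring)
  have "b \<in> (+>) I ` carrier R"
    using assms(1) quotient_surj by simp
  then obtain x where x: "x \<in> carrier R" "b = I +> x"
    by auto
  have xI: "x \<notin> I"
    using x assms(2) quotient_zero_iff by auto
  define J where "J = {mulop R ps x \<oplus> i | ps i. set ps \<subseteq> pairs \<and> i \<in> I}"
  have J: "ideal J R"
  proof (rule idealI')
    show "J \<subseteq> carrier R"
      using x(1) by (auto simp: J_def)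
    have "\<zero> = mulop R [] x \<oplus> \<zero>"
      by simp
    then show "\<zero> \<in> J"
      unfolding J_def by (intro CollectI exI[of _ "[]"] exI[of _ \<zero>]) simp
  next
    fix s t assume "s \<in> J" "t \<in> J"
    then obtain ps i qs j where s: "s = mulop R ps x \<oplus> i" "set ps \<subseteq> pairs" "i \<in> I"
      and t: "t = mulop R qs x \<oplus> j" "set qs \<subseteq> pairs" "j \<in> I"
      unfolding J_def by blast
    then have "s \<oplus> t = mulop R (ps @ qs) x \<oplus> (i \<oplus> j)"
      using x(1) by (simp add: mulop_append a_ac)
    then show "s \<oplus> t \<in> J"
      using s(2,3) t(2,3) a_closed unfolding J_def
      by (intro CollectI exI[of _ "ps @ qs"] exI[of _ "i \<oplus> j"]) auto
  next
    fix a s assume a: "a \<in> carrier R" and "s \<in> J"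
    then obtain ps i where s: "s = mulop R ps x \<oplus> i" "set ps \<subseteq> pairs" "i \<in> I"
      unfolding J_def by blast
    have "a \<otimes> s = mulop R (map (\<lambda>p. (a \<otimes> fst p, snd p)) ps) x \<oplus> a \<otimes> i"
      using s a x(1) by (simp add: mulop_left r_distr)
    moreover have "set (map (\<lambda>p. (a \<otimes> fst p, snd p)) ps) \<subseteq> pairs"
      using s(2) a by auto
    ultimately show "a \<otimes> s \<in> J"
      using I_l_closed[OF s(3) a] unfolding J_def by blast
    have "s \<otimes> a = mulop R (map (\<lambda>p. (fst p, snd p \<otimes> a)) ps) x \<oplus> i \<otimes> a"
      using s a x(1) by (simp add: mulop_right l_distr)
    moreover have "set (map (\<lambda>p. (fst p, snd p \<otimes> a)) ps) \<subseteq> pairs"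
      using s(2) a by auto
    ultimately show "s \<otimes> a \<in> J"
      using I_r_closed[OF s(3) a] unfolding J_def by blast
  qed
  have "I \<subseteq> J"
  proof
    fix i assume i: "i \<in> I"
    then have "i = mulop R [] x \<oplus> i"
      by simp
    then show "i \<in> J"
      unfolding J_def using i by (intro CollectI exI[of _ "[]"] exI[of _ i]) simp
  qed
  moreover have "x \<in> J"
    unfolding J_def using x(1) by (intro CollectI exI[of _ "[(\<one>, \<one>)]"] exI[of _ \<zero>]) simp
  ultimately have "J = carrier R"
    using I_maximal[OF J] ideal.Icarr[OF J] xI by blast
  then have "\<one> \<in> J"
    by simp
  then obtain ps i where ps: "\<one> = mulop R ps x \<oplus> i" "set ps \<subseteq> pairs" "i \<in> I"
    unfolding J_def by blast
  let ?qs = "map (map_prod ((+>) I) ((+>) I)) ps"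
  have hom: "I +> mulop R qs x = mulop (R Quot I) (map (map_prod ((+>) I) ((+>) I)) qs) b"
    if "set qs \<subseteq> pairs" for qs
    using that
  proof (induction qs)
    case (Cons q qs)
    then have "fst q \<in> carrier R" "snd q \<in> carrier R" "mulop R qs x \<in> carrier R"
      using x(1) by auto
    then show ?case
      using Cons x by (simp add: map_prod_def split_beta)
  qed simp
  have "I +> i = \<zero>\<^bsub>R Quot I\<^esub>"
    using ps(3) quotient_zero_iff by simp
  then have "\<one>\<^bsub>R Quot I\<^esub> = mulop (R Quot I) ?qs b \<oplus>\<^bsub>R Quot I\<^esub> \<zero>\<^bsub>R Quot I\<^esub>"
    using hom[OF ps(2)] ps x(1) by (metis Icarr h.hom_add h.hom_one mulop_closed)
  moreover have qs: "set ?qs \<subseteq> carrier (R Quot I) \<times> carrier (R Quot I)"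
    using ps(2) by (auto simp: map_prod_def)
  ultimately show ?thesis
    using h.S.mulop_closed[OF qs assms(1)] by (metis h.S.r_zero)
qed

text \<open>In a commutative ring an operator is multiplication by its value at 1, so an operator
  sending b to 1 yields the inverse of b.\<close>

lemma (in ring) field_if_simple_commutative:
  assumes "\<And>b. b \<in> carrier R \<Longrightarrow> b \<noteq> \<zero> \<Longrightarrow> \<exists>ps. set ps \<subseteq> pairs \<and> mulop R ps b = \<one>"
    and "\<one> \<noteq> \<zero>" "carrier R \<subseteq> ring_center R"
  shows "field R"
proof -
  interpret cring R
    using assms(3) by unfold_locales (auto simp: ring_center_def)
  have mul: "mulop R ps b = mulop R ps \<one> \<otimes> b" if "set ps \<subseteq> pairs" "b \<in> carrier R" for ps b
    using that by (induction ps) (auto simp: l_distr r_distr m_ac)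
  have "b \<in> Units R" if b: "b \<in> carrier R" "b \<noteq> \<zero>" for b
  proof -
    obtain ps where ps: "set ps \<subseteq> pairs" "mulop R ps b = \<one>"
      using assms(1)[OF b] by blast
    then have "mulop R ps \<one> \<otimes> b = \<one>" "b \<otimes> mulop R ps \<one> = \<one>" "mulop R ps \<one> \<in> carrier R"
      using mul[OF ps(1) b(1)] b(1) m_comm by simp_all
    then show ?thesis
      using b(1) unfolding Units_def by blast
  qed
  moreover have "\<zero> \<notin> Units R"
    using assms(2) by (auto simp: Units_def)
  ultimately have "Units R = carrier R - {\<zero>}"
    by (auto simp: Units_def)
  then show ?thesis
    by (rule cring_fieldI)
qed

theorem (in ring) has_maximal_subring_or_field_quotient:
  assumes "\<one> \<noteq> \<zero>" "center_integral R"
  shows "has_maximal_subring R \<or> (\<exists>M. ideal M R \<and> field (R Quot M))"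
proof -
  have "ideal {\<zero>} R"
    by (rule zeroideal)
  then obtain M where M: "maximalideal M R"
    using exists_maximalideal[of "{\<zero>}"] assms(1) by auto
  interpret maximalideal M R by (rule M)
  let ?S = "R Quot M"
  interpret h: ring_hom_ring R ?S "(+>) M"
    by (rule rcos_ring_hom_ring)
  have "\<one> \<notin> M"
    using I_notcarr one_imp_carrier by blast
  then have one: "\<one>\<^bsub>?S\<^esub> \<noteq> \<zero>\<^bsub>?S\<^esub>"
    using quotient_zero_iff[of \<one>] by simp
  show ?thesis
  proof (cases "carrier ?S \<subseteq> ring_center ?S")
    case True
    then have "field ?S"
      using h.S.field_if_simple_commutative mulop_quotient_simple one by blast
    then show ?thesis
      using is_ideal by blast
  next
    case False
    then obtain a where "a \<in> carrier ?S" "a \<notin> ring_center ?S"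
      by blast
    then have "has_maximal_subring ?S"
      using h.S.has_maximal_subring_if_simple_noncommutative[OF mulop_quotient_simple one]
        h.center_integral_surjective_image[OF quotient_surj assms(2)] by blast
    then show ?thesis
      using has_maximal_subring_if_surjective_hom[OF h.ring_hom_ring_axioms quotient_surj] by blast
  qed
qed

section \<open>Roots, the prime subring and products\<close>

text \<open>Synthetic division: the coefficients of the quotient by t - r, which are the Horner
  tails at r.\<close>

fun deflate :: "('a, 'b) ring_scheme \<Rightarrow> 'a \<Rightarrow> 'a list \<Rightarrow> 'a list" where
  "deflate R r [] = []"
| "deflate R r [c] = []"
| "deflate R r (c # d # cs) = horner R r (d # cs) # deflate R r (d # cs)"

lemma length_deflate: "length (deflate R r cs) = length cs - 1"
  by (induction R r cs rule: deflate.induct) auto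

context ring
begin

lemma deflate_closed:
  assumes "r \<in> carrier R"
  shows "set cs \<subseteq> carrier R \<Longrightarrow> set (deflate R r cs) \<subseteq> carrier R"
proof (induction cs)
  case (Cons c cs)
  then show ?case
    using assms by (cases cs) auto
qed simp

lemma deflate_zeros:
  assumes "r \<in> carrier R"
  shows "set cs \<subseteq> carrier R \<Longrightarrow> horner R r cs = \<zero> \<Longrightarrow> set (deflate R r cs) \<subseteq> {\<zero>} \<Longrightarrow> set cs \<subseteq> {\<zero>}"
proof (induction cs)
  case (Cons c cs)
  show ?case
  proof (cases cs)
    case Nil
    then show ?thesis
      using Cons.prems assms by auto
  next
    case (Cons d ds)
    then have h: "horner R r cs = \<zero>" "set (deflate R r cs) \<subseteq> {\<zero>}"
      using Cons.prems(3) by auto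
    then have "set cs \<subseteq> {\<zero>}"
      using Cons.IH Cons.prems(1) by auto
    moreover have "c = \<zero>"
      using Cons.prems(1,2) h(1) assms by simp
    ultimately show ?thesis
      by auto
  qed
qed simp

end

lemma (in cring) horner_deflate:
  assumes r: "r \<in> carrier R" and x: "x \<in> carrier R"
  shows "set cs \<subseteq> carrier R \<Longrightarrow>
    horner R x cs = horner R r cs \<oplus> (x \<ominus> r) \<otimes> horner R x (deflate R r cs)"
proof (induction cs)
  case (Cons c cs)
  show ?case
  proof (cases cs)
    case Nil
    then show ?thesis
      using Cons.prems assms by simp
  next
    case (Cons d ds)
    define p where "p = horner R x cs"
    define q where "q = horner R r cs"
    define e where "e = horner R x (deflate R r cs)"
    have R: "c \<in> carrier R" "q \<in> carrier R" "e \<in> carrier R"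
      using Cons.prems assms deflate_closed[OF r, of cs] by (auto simp: q_def e_def)
    have "p = q \<oplus> (x \<ominus> r) \<otimes> e"
      using Cons.IH Cons.prems by (simp add: p_def q_def e_def)
    moreover have "c \<oplus> x \<otimes> (q \<oplus> (x \<ominus> r) \<otimes> e) = (c \<oplus> r \<otimes> q) \<oplus> (x \<ominus> r) \<otimes> (q \<oplus> x \<otimes> e)"
      using R r x by algebra
    ultimately show ?thesis
      using Cons by (simp add: p_def q_def e_def)
  qed
qed (use assms in simp)

text \<open>Dividing by t - r shortens the list by one and loses at most the root r. The length
  exceeds the degree, but any bound depending on the length alone serves later.\<close>

lemma (in domain) card_horner_roots:
  assumes "set cs \<subseteq> carrier R" "\<not> set cs \<subseteq> {\<zero>}"
  shows "finite {x \<in> carrier R. horner R x cs = \<zero>} \<and>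
    card {x \<in> carrier R. horner R x cs = \<zero>} \<le> length cs"
  using assms
proof (induction "length cs" arbitrary: cs rule: less_induct)
  case less
  show ?case
  proof (cases "{x \<in> carrier R. horner R x cs = \<zero>} = {}")
    case True
    then show ?thesis
      by (simp only: finite.emptyI card.empty) simp
  next
    case False
    then obtain r where r: "r \<in> carrier R" "horner R r cs = \<zero>"
      by blast
    let ?ds = "deflate R r cs"
    let ?D = "{x \<in> carrier R. horner R x ?ds = \<zero>}"
    have len: "length ?ds < length cs" "length cs = Suc (length ?ds)"
      using less.prems(2) by (cases cs; simp add: length_deflate)+
    have ds: "set ?ds \<subseteq> carrier R" "\<not> set ?ds \<subseteq> {\<zero>}"
      using deflate_closed[OF r(1) less.prems(1)] deflate_zeros[OF r(1) less.prems(1) r(2)] less.prems(2)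
      by auto
    have IH: "finite ?D" "card ?D \<le> length ?ds"
      using less.hyps[OF len(1) ds] by auto
    have sub: "{x \<in> carrier R. horner R x cs = \<zero>} \<subseteq> insert r ?D"
    proof
      fix x assume "x \<in> {x \<in> carrier R. horner R x cs = \<zero>}"
      then have x: "x \<in> carrier R" "horner R x cs = \<zero>"
        by auto
      then have "(x \<ominus> r) \<otimes> horner R x ?ds = \<zero>"
        using horner_deflate[OF r(1) x(1) less.prems(1)] r ds(1) by simp
      then have "x \<ominus> r = \<zero> \<or> horner R x ?ds = \<zero>"
        using integral x r(1) ds(1) by (metis horner_closed minus_closed)
      then show "x \<in> insert r ?D"
        using x(1) r(1) by auto
    qed
    have "card {x \<in> carrier R. horner R x cs = \<zero>} \<le> card (insert r ?D)"
      using sub IH(1) by (intro card_mono) auto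
    also have "\<dots> \<le> length cs"
      using IH len(2) by (simp add: card_insert_if)
    finally show ?thesis
      using finite_subset[OF sub] IH(1) by simp
  qed
qed

section \<open>Integer multiples of one and the characteristic\<close>

definition embed_int :: "('a, 'b) ring_scheme \<Rightarrow> int \<Rightarrow> 'a" where
  "embed_int R k = [k] \<cdot>\<^bsub>R\<^esub> \<one>\<^bsub>R\<^esub>"

context ring
begin

lemma embed_int_closed [simp]: "embed_int R k \<in> carrier R"
  by (simp add: embed_int_def)

lemma embed_int_1: "embed_int R 1 = \<one>"
  by (simp add: embed_int_def)

lemma embed_int_add: "embed_int R (k + l) = embed_int R k \<oplus> embed_int R l"
  by (simp add: embed_int_def add.int_pow_mult)

lemma embed_int_neg: "embed_int R (- k) = \<ominus> embed_int R k"
  by (simp add: embed_int_def add.int_pow_neg)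

lemma embed_int_mult: "embed_int R (k * l) = embed_int R k \<otimes> embed_int R l"
  by (simp add: embed_int_def add_pow_ldistr_int add.int_pow_pow mult.commute)

text \<open>The additive order of 1 is the characteristic, with the value 0 for infinite
  order.\<close>

lemma embed_int_eq_zero_iff: "embed_int R k = \<zero> \<longleftrightarrow> int (add.ord \<one>) dvd k"
  by (simp add: embed_int_def add.int_pow_eq_id)

lemma prime_subring: "subring (range (embed_int R)) R"
proof (rule subringI)
  show "\<one> \<in> range (embed_int R)"
    by (metis embed_int_1 rangeI)
qed (auto simp flip: embed_int_add embed_int_mult embed_int_neg)

end

lemma (in ring_hom_ring) hom_embed_int: "h (embed_int R k) = embed_int S k"
  using group_hom.hom_int_pow[OF a_group_hom, of "\<one>\<^bsub>R\<^esub>" k] by (simp add: embed_int_def add_pow_def)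

section \<open>Direct products and their homomorphisms\<close>

lemma product_ring_simps [simp]:
  "carrier (product_ring I T) = (\<Pi>\<^sub>E i\<in>I. carrier (T i))"
  "x \<otimes>\<^bsub>product_ring I T\<^esub> y = (\<lambda>i\<in>I. x i \<otimes>\<^bsub>T i\<^esub> y i)"
  "x \<oplus>\<^bsub>product_ring I T\<^esub> y = (\<lambda>i\<in>I. x i \<oplus>\<^bsub>T i\<^esub> y i)"
  "\<one>\<^bsub>product_ring I T\<^esub> = (\<lambda>i\<in>I. \<one>\<^bsub>T i\<^esub>)"
  "\<zero>\<^bsub>product_ring I T\<^esub> = (\<lambda>i\<in>I. \<zero>\<^bsub>T i\<^esub>)"
  by (simp_all add: product_ring_def)

lemma ring_product_ring:
  assumes "\<And>i. i \<in> I \<Longrightarrow> ring (T i)"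
  shows "ring (product_ring I T)"
proof (rule ringI)
  have r: "\<And>i. i \<in> I \<Longrightarrow> abelian_group (T i)" "\<And>i. i \<in> I \<Longrightarrow> Group.monoid (T i)"
    using assms ring.is_abelian_group ring.is_monoid by auto
  show "abelian_group (product_ring I T)"
  proof (rule abelian_groupI)
    fix x assume x: "x \<in> carrier (product_ring I T)"
    let ?y = "\<lambda>i\<in>I. \<ominus>\<^bsub>T i\<^esub> x i"
    have "?y \<in> carrier (product_ring I T)"
      using x r by (auto intro!: abelian_group.a_inv_closed)
    moreover have "?y \<oplus>\<^bsub>product_ring I T\<^esub> x = \<zero>\<^bsub>product_ring I T\<^esub>"
      using x r by (auto intro!: abelian_group.l_neg restrict_ext)
    ultimately show "\<exists>y\<in>carrier (product_ring I T). y \<oplus>\<^bsub>product_ring I T\<^esub> x = \<zero>\<^bsub>product_ring I T\<^esub>"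
      by blast
  qed (use assms in \<open>auto simp: ring.ring_simprules PiE_iff restrict_def extensional_def fun_eq_iff\<close>)
  show "Group.monoid (product_ring I T)"
    by (rule Group.monoidI) (use assms in \<open>auto simp: ring.ring_simprules monoid.r_one[OF ring.is_monoid] PiE_iff restrict_def extensional_def fun_eq_iff\<close>)
qed (use assms in \<open>auto simp: ring.ring_simprules PiE_iff restrict_def extensional_def fun_eq_iff\<close>)

lemma product_ring_proj:
  assumes "\<And>i. i \<in> I \<Longrightarrow> ring (T i)" "j \<in> I"
  shows "ring_hom_ring (product_ring I T) (T j) (\<lambda>x. x j)"
  using assms by (intro ring_hom_ringI ring_product_ring) auto

lemma product_ring_proj_surj:
  assumes "\<And>i. i \<in> I \<Longrightarrow> ring (T i)" "j \<in> I"
  shows "(\<lambda>x. x j) ` carrier (product_ring I T) = carrier (T j)"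
proof
  show "carrier (T j) \<subseteq> (\<lambda>x. x j) ` carrier (product_ring I T)"
  proof
    fix a assume a: "a \<in> carrier (T j)"
    have "(\<lambda>i\<in>I. if i = j then a else \<zero>\<^bsub>T i\<^esub>) \<in> carrier (product_ring I T)"
      using a assms by (auto simp: ring.ring_simprules)
    moreover have "a = (\<lambda>i\<in>I. if i = j then a else \<zero>\<^bsub>T i\<^esub>) j"
      using assms(2) by simp
    ultimately show "a \<in> (\<lambda>x. x j) ` carrier (product_ring I T)"
      by (intro image_eqI[where f = "\<lambda>x. x j"])
  qed
qed (use assms(2) in auto)

lemma product_ring_reindex_hom:
  assumes "\<And>i. i \<in> I \<Longrightarrow> ring (T i)" "\<And>m. ring_hom_ring (T (f m)) (K m) (h m)" "\<And>m. f m \<in> I"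
  shows "ring_hom_ring (product_ring I T) (product_ring UNIV K) (\<lambda>x m. h m (x (f m)))"
proof (rule ring_hom_ringI)
  show "ring (product_ring I T)"
    by (rule ring_product_ring) (rule assms(1))
  show "ring (product_ring UNIV K)"
    by (rule ring_product_ring) (use assms(2) ring_hom_ring.axioms(2) in blast)
  have hom: "h m \<in> ring_hom (T (f m)) (K m)" for m
    using assms(2) ring_hom_ring.homh by blast
  show "(\<lambda>m. h m (x (f m))) \<in> carrier (product_ring UNIV K)" if "x \<in> carrier (product_ring I T)" for x
    using that assms(3) ring_hom_closed[OF hom] by auto
qed (use assms(3) in \<open>auto simp: ring_hom_mult[OF ring_hom_ring.homh[OF assms(2)]]
    ring_hom_add[OF ring_hom_ring.homh[OF assms(2)]] ring_hom_one[OF ring_hom_ring.homh[OF assms(2)]] PiE_iff\<close>)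

lemma product_ring_reindex_surj:
  assumes "\<And>i. i \<in> I \<Longrightarrow> ring (T i)" "\<And>m. h m ` carrier (T (f m)) = carrier (K m)"
    and "\<And>m. f m \<in> I" "inj f"
  shows "(\<lambda>x m. h m (x (f m))) ` carrier (product_ring I T) = carrier (product_ring UNIV K)"
proof
  show "(\<lambda>x m. h m (x (f m))) ` carrier (product_ring I T) \<subseteq> carrier (product_ring UNIV K)"
  proof
    fix y assume "y \<in> (\<lambda>x m. h m (x (f m))) ` carrier (product_ring I T)"
    then obtain x where x: "x \<in> carrier (product_ring I T)" "y = (\<lambda>m. h m (x (f m)))"
      by blast
    then have "y m \<in> h m ` carrier (T (f m))" for m
      using assms(3) by (auto intro!: imageI)
    then show "y \<in> carrier (product_ring UNIV K)"
      using assms(2) by (auto simp: PiE_iff)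
  qed
  show "carrier (product_ring UNIV K) \<subseteq> (\<lambda>x m. h m (x (f m))) ` carrier (product_ring I T)"
  proof
    fix y assume y: "y \<in> carrier (product_ring UNIV K)"
    have "\<exists>t. t \<in> carrier (T (f m)) \<and> h m t = y m" for m
    proof -
      have "y m \<in> h m ` carrier (T (f m))"
        using y assms(2) by auto
      then show ?thesis
        by auto
    qed
    then obtain t where t: "\<And>m. t m \<in> carrier (T (f m))" "\<And>m. h m (t m) = y m"
      by metis
    \<comment> \<open>Injectivity of \<open>f\<close> makes the preimage of an index unique;
      coordinates outside the range are filled with zero.\<close>
    define x where "x = (\<lambda>i\<in>I. if i \<in> range f then t (inv_into UNIV f i) else \<zero>\<^bsub>T i\<^esub>)"
    have xf: "x (f m) = t m" for m
      using assms(3,4) by (simp add: x_def)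
    have "x \<in> carrier (product_ring I T)"
      using assms(1,4) t(1) by (auto simp: x_def ring.ring_simprules)
    moreover have "y = (\<lambda>m. h m (x (f m)))"
      using xf t(2) by simp
    ultimately show "y \<in> (\<lambda>x m. h m (x (f m))) ` carrier (product_ring I T)"
      by blast
  qed
qed

section \<open>Countable products of fields\<close>

text \<open>Finite stages that exhaust all integer polynomials, bounding length and coefficients by
  the same number.\<close>

definition bounded_int_lists :: "nat \<Rightarrow> int list set" where
  "bounded_int_lists r = {ds. set ds \<subseteq> {- int r..int r} \<and> length ds \<le> r}"

text \<open>Lists that vanish in \<open>R\<close> are exempt, as every element is a root of them; in
  positive characteristic there are nonzero integer lists of this kind.\<close>

definition avoids_roots :: "('a, 'b) ring_scheme \<Rightarrow> nat \<Rightarrow> 'a \<Rightarrow> bool" where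
  "avoids_roots R r x \<longleftrightarrow> (\<forall>ds\<in>bounded_int_lists r.
    horner R x (map (embed_int R) ds) = \<zero>\<^bsub>R\<^esub> \<longrightarrow> set (map (embed_int R) ds) \<subseteq> {\<zero>\<^bsub>R\<^esub>})"

lemma finite_bounded_int_lists: "finite (bounded_int_lists r)"
  unfolding bounded_int_lists_def by (rule finite_lists_length_le) simp

text \<open>The ring is then covered by the root sets of finitely many polynomials, each with at
  most r elements. The bound depends on r alone, so it is common to all fields that fail at stage
  r.\<close>

lemma (in domain) card_bound_if_no_avoiding:
  assumes "\<nexists>x. x \<in> carrier R \<and> avoids_roots R r x"
  shows "finite (carrier R) \<and> card (carrier R) \<le> card (bounded_int_lists r) * r"
proof -
  let ?B = "bounded_int_lists r"
  define D where "D ds = (if set (map (embed_int R) ds) \<subseteq> {\<zero>} then {}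
    else {x \<in> carrier R. horner R x (map (embed_int R) ds) = \<zero>})" for ds
  have D: "finite (D ds) \<and> card (D ds) \<le> r" if "ds \<in> ?B" for ds
  proof -
    have "set (map (embed_int R) ds) \<subseteq> carrier R" "length ds \<le> r"
      using that by (auto simp: bounded_int_lists_def)
    then show ?thesis
      using card_horner_roots[of "map (embed_int R) ds"]
      by (cases "set (map (embed_int R) ds) \<subseteq> {\<zero>}") (auto simp: D_def)
  qed
  have cover: "carrier R \<subseteq> (\<Union>ds\<in>?B. D ds)"
    using assms by (fastforce simp: avoids_roots_def D_def)
  have fin: "finite (\<Union>ds\<in>?B. D ds)"
    using D finite_bounded_int_lists by blast
  have "card (carrier R) \<le> card (\<Union>ds\<in>?B. D ds)"
    by (rule card_mono[OF fin cover])
  also have "\<dots> \<le> (\<Sum>ds\<in>?B. card (D ds))"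
    by (rule card_UN_le[OF finite_bounded_int_lists])
  also have "\<dots> \<le> card ?B * r"
    using sum_bounded_above[of ?B "\<lambda>ds. card (D ds)" r] D by simp
  finally show ?thesis
    using finite_subset[OF cover fin] by simp
qed

text \<open>The prime subring omits (1, 0): an integer that is 0 in \<open>S\<close> is 0 in
  \<open>R\<close> by equality of the characteristics. The finite carrier itself serves as
  generating set.\<close>

lemma has_maximal_subring_RDirProd:
  assumes "ring R" "ring S" "finite (carrier R)" "finite (carrier S)" "\<one>\<^bsub>R\<^esub> \<noteq> \<zero>\<^bsub>R\<^esub>"
    and same: "group.ord (add_monoid R) \<one>\<^bsub>R\<^esub> = group.ord (add_monoid S) \<one>\<^bsub>S\<^esub>"
  shows "has_maximal_subring (RDirProd R S)"
proof -
  interpret R: ring R by fact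
  interpret S: ring S by fact
  interpret P: ring "RDirProd R S"
    by (rule RDirProd_ring[OF assms(1,2)])
  have fst: "ring_hom_ring (RDirProd R S) R fst" and snd: "ring_hom_ring (RDirProd R S) S snd"
    by (rule ring_hom_ringI; use P.ring_axioms assms(1,2) in
        \<open>auto simp: RDirProd_carrier RDirProd_def DirProd_def monoid.defs\<close>)+
  have "(\<one>\<^bsub>R\<^esub>, \<zero>\<^bsub>S\<^esub>) \<noteq> embed_int (RDirProd R S) k" for k
  proof
    assume "(\<one>\<^bsub>R\<^esub>, \<zero>\<^bsub>S\<^esub>) = embed_int (RDirProd R S) k"
    then have "embed_int R k = \<one>\<^bsub>R\<^esub>" "embed_int S k = \<zero>\<^bsub>S\<^esub>"
      using ring_hom_ring.hom_embed_int[OF fst, of k] ring_hom_ring.hom_embed_int[OF snd, of k]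
      by (metis fst_conv, metis snd_conv)
    moreover from this have "embed_int R k = \<zero>\<^bsub>R\<^esub>"
      using R.embed_int_eq_zero_iff S.embed_int_eq_zero_iff same by metis
    ultimately show False
      using assms(5) by simp
  qed
  then have "(\<one>\<^bsub>R\<^esub>, \<zero>\<^bsub>S\<^esub>) \<notin> range (embed_int (RDirProd R S))"
    by blast
  moreover have "(\<one>\<^bsub>R\<^esub>, \<zero>\<^bsub>S\<^esub>) \<in> carrier (RDirProd R S)"
    by (simp add: RDirProd_carrier)
  ultimately have "range (embed_int (RDirProd R S)) \<noteq> carrier (RDirProd R S)"
    by blast
  then show ?thesis
  proof (rule P.has_maximal_subring_if_finitely_generated[OF P.prime_subring])
    show "finite (carrier (RDirProd R S))"
      using assms(3,4) by (simp add: RDirProd_carrier)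
    show "B = carrier (RDirProd R S)"
      if "subring B (RDirProd R S)" "carrier (RDirProd R S) \<subseteq> B" for B
      using subringE(1)[OF that(1)] that(2) by blast
  qed simp
qed

lemma has_maximal_subring_product_finite:
  assumes "\<And>m::nat. ring (K m)" "i \<noteq> j" "finite (carrier (K i))" "finite (carrier (K j))"
    and "\<one>\<^bsub>K i\<^esub> \<noteq> \<zero>\<^bsub>K i\<^esub>"
    and "group.ord (add_monoid (K i)) \<one>\<^bsub>K i\<^esub> = group.ord (add_monoid (K j)) \<one>\<^bsub>K j\<^esub>"
  shows "has_maximal_subring (product_ring UNIV K)"
proof (rule has_maximal_subring_if_surjective_hom)
  show "ring_hom_ring (product_ring UNIV K) (RDirProd (K i) (K j)) (\<lambda>x. (x i, x j))"
    by (rule ring_hom_ringI[OF ring_product_ring RDirProd_ring])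
      (use assms(1) in \<open>auto simp: RDirProd_def DirProd_def monoid.defs\<close>)
  show "(\<lambda>x. (x i, x j)) ` carrier (product_ring UNIV K) = carrier (RDirProd (K i) (K j))"
  proof
    show "carrier (RDirProd (K i) (K j)) \<subseteq> (\<lambda>x. (x i, x j)) ` carrier (product_ring UNIV K)"
    proof
      fix p assume p: "p \<in> carrier (RDirProd (K i) (K j))"
      define x where "x m = (if m = i then fst p else if m = j then snd p else \<zero>\<^bsub>K m\<^esub>)" for m
      have "x \<in> carrier (product_ring UNIV K)"
        using p assms(1) by (auto simp: x_def RDirProd_carrier ring.ring_simprules)
      moreover have "p = (x i, x j)"
        using assms(2) by (simp add: x_def)
      ultimately show "p \<in> (\<lambda>x. (x i, x j)) ` carrier (product_ring UNIV K)"
        by blast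
    qed
  qed (auto simp: RDirProd_carrier)
  show "has_maximal_subring (RDirProd (K i) (K j))"
    by (rule has_maximal_subring_RDirProd) (use assms in auto)
qed

text \<open>If the coordinates of \<open>x\<close> eventually avoid the roots of each integer polynomial, then the image
  of \<open>x\<close> modulo a maximal ideal containing all finitely supported families is transcendental
  over the prime subring.\<close>

lemma has_maximal_subring_product_avoiding:
  assumes K: "\<And>m::nat. field (K m)"
    and x: "\<And>m. x m \<in> carrier (K m)" "\<And>r. finite {m. \<not> avoids_roots (K m) r (x m)}"
  shows "has_maximal_subring (product_ring UNIV K)"
proof -
  let ?P = "product_ring UNIV K"
  have cr: "ring (K m)" "cring (K m)" for m
    using K field.is_ring by (auto simp: fieldE(1))
  interpret P: ring ?P
    by (rule ring_product_ring) (rule cr)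
  interpret P: cring ?P
    by unfold_locales (auto simp: restrict_def fun_eq_iff PiE_iff intro: cring.cring_simprules(14)[OF cr(2)])
  define J where "J = {t \<in> carrier ?P. finite {m. t m \<noteq> \<zero>\<^bsub>K m\<^esub>}}"
  have "ideal J ?P"
  proof (rule P.idealI')
    show "J \<subseteq> carrier ?P"
      by (auto simp: J_def)
    show "\<zero>\<^bsub>?P\<^esub> \<in> J"
      using P.zero_closed by (auto simp: J_def)
  next
    fix s t assume st: "s \<in> J" "t \<in> J"
    then have "{m. (s \<oplus>\<^bsub>?P\<^esub> t) m \<noteq> \<zero>\<^bsub>K m\<^esub>} \<subseteq> {m. s m \<noteq> \<zero>\<^bsub>K m\<^esub>} \<union> {m. t m \<noteq> \<zero>\<^bsub>K m\<^esub>}"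
      using cr(1) by (auto simp: ring.ring_simprules)
    then have "finite {m. (s \<oplus>\<^bsub>?P\<^esub> t) m \<noteq> \<zero>\<^bsub>K m\<^esub>}"
      using st by (auto simp: J_def intro: finite_subset simp del: product_ring_simps)
    then show "s \<oplus>\<^bsub>?P\<^esub> t \<in> J"
      using st P.add.m_closed by (auto simp: J_def simp del: product_ring_simps)
  next
    fix a s assume a: "a \<in> carrier ?P" and s: "s \<in> J"
    have "{m. (a \<otimes>\<^bsub>?P\<^esub> s) m \<noteq> \<zero>\<^bsub>K m\<^esub>} \<subseteq> {m. s m \<noteq> \<zero>\<^bsub>K m\<^esub>}"
      using a cr(1) by (auto simp: PiE_iff ring.ring_simprules)
    then have "finite {m. (a \<otimes>\<^bsub>?P\<^esub> s) m \<noteq> \<zero>\<^bsub>K m\<^esub>}"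
      using s by (auto simp: J_def intro: finite_subset simp del: product_ring_simps)
    then show "a \<otimes>\<^bsub>?P\<^esub> s \<in> J"
      using s a P.m_closed by (auto simp: J_def simp del: product_ring_simps)
    then show "s \<otimes>\<^bsub>?P\<^esub> a \<in> J"
      using s a P.m_comm by (auto simp: J_def simp del: product_ring_simps)
  qed
  moreover have "\<one>\<^bsub>?P\<^esub> \<notin> J"
    using fieldE(2)[OF K] by (auto simp: J_def)
  ultimately obtain N where N: "maximalideal N ?P" "J \<subseteq> N"
    using P.exists_maximalideal by blast
  interpret maximalideal N ?P by (rule N(1))
  let ?Q = "?P Quot N"
  interpret h: ring_hom_ring ?P ?Q "(+>\<^bsub>?P\<^esub>) N"
    by (rule rcos_ring_hom_ring)
  interpret Q: field ?Q
    by (rule quotient_is_field[OF P.is_cring])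
  have xP: "x \<in> carrier ?P"
    using x(1) by (simp add: PiE_iff)
  have cl: "set (map (embed_int ?P) ds) \<subseteq> carrier ?P" for ds
    using P.embed_int_closed by (auto simp del: product_ring_simps)
  have vanish: "embed_int ?P d \<in> N" if d: "d \<in> set ds"
    and f: "horner ?P x (map (embed_int ?P) ds) \<in> N" for d ds
  proof -
    define f where "f = horner ?P x (map (embed_int ?P) ds)"
    have fP: "f \<in> carrier ?P"
      using xP unfolding f_def by (rule P.horner_closed[OF _ cl])
    have coord: "f m = horner (K m) (x m) (map (embed_int (K m)) ds)" for m
    proof -
      interpret p: ring_hom_ring ?P "K m" "\<lambda>t. t m"
        by (rule product_ring_proj) (use cr in auto)
      show ?thesis
        unfolding f_def using p.hom_horner[OF xP cl] by (simp add: comp_def p.hom_embed_int)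
    qed
    \<comment> \<open>A pointwise quasi-inverse: \<open>f\<close> times \<open>w\<close> is 1 on the
      support of \<open>f\<close> and 0 elsewhere.\<close>
    define w where "w m = (if f m = \<zero>\<^bsub>K m\<^esub> then \<zero>\<^bsub>K m\<^esub> else inv\<^bsub>K m\<^esub> (f m))" for m
    have w: "w m \<in> carrier (K m)" "f m \<noteq> \<zero>\<^bsub>K m\<^esub> \<Longrightarrow> f m \<otimes>\<^bsub>K m\<^esub> w m = \<one>\<^bsub>K m\<^esub>" for m
    proof -
      interpret field "K m" by (rule K)
      have "f m \<in> carrier (K m)"
        using fP by auto
      then show "w m \<in> carrier (K m)" "f m \<noteq> \<zero>\<^bsub>K m\<^esub> \<Longrightarrow> f m \<otimes>\<^bsub>K m\<^esub> w m = \<one>\<^bsub>K m\<^esub>"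
        using field_Units by (auto simp: w_def)
    qed
    have wP: "w \<in> carrier ?P"
      using w(1) by (simp add: PiE_iff)
    define e where "e = embed_int ?P d"
    have eP: "e \<in> carrier ?P"
      by (simp only: e_def P.embed_int_closed)
    \<comment> \<open>The part of \<open>e\<close> on the zero set of \<open>f\<close>. Where
      \<open>x m\<close> avoids roots at the stage of \<open>ds\<close>, vanishing of
      \<open>f m\<close> forces \<open>e m\<close> to vanish, so \<open>g\<close> has finite support
      and lies in \<open>N\<close>. The remaining part is a multiple of \<open>f\<close>.\<close>
    define g where "g = e \<ominus>\<^bsub>?P\<^esub> e \<otimes>\<^bsub>?P\<^esub> (f \<otimes>\<^bsub>?P\<^esub> w)"
    have gP: "g \<in> carrier ?P"
      unfolding g_def by (intro P.minus_closed P.m_closed eP fP wP)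
    define r where "r = Max (insert (length ds) ((\<lambda>d. nat \<bar>d\<bar>) ` set ds))"
    have r: "ds \<in> bounded_int_lists r"
    proof -
      have "length ds \<le> r" "\<forall>c\<in>set ds. nat \<bar>c\<bar> \<le> r"
        unfolding r_def by (auto intro!: Max_ge)
      then show ?thesis
        by (force simp: bounded_int_lists_def)
    qed
    have "g m = \<zero>\<^bsub>K m\<^esub>" if "avoids_roots (K m) r (x m)" for m
    proof -
      interpret p: ring_hom_ring ?P "K m" "\<lambda>t. t m"
        by (rule product_ring_proj) (use cr in auto)
      have gm: "g m = e m \<ominus>\<^bsub>K m\<^esub> e m \<otimes>\<^bsub>K m\<^esub> (f m \<otimes>\<^bsub>K m\<^esub> w m)"
        unfolding g_def a_minus_def using p.hom_add p.hom_mult p.hom_a_inv eP fP wP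
        by (simp del: product_ring_simps)
      have em: "e m \<in> carrier (K m)" "f m \<in> carrier (K m)"
        using p.hom_closed eP fP by blast+
      show ?thesis
      proof (cases "f m = \<zero>\<^bsub>K m\<^esub>")
        case True
        then have "set (map (embed_int (K m)) ds) \<subseteq> {\<zero>\<^bsub>K m\<^esub>}"
          using that r coord by (auto simp: avoids_roots_def)
        then have "e m = \<zero>\<^bsub>K m\<^esub>"
          using d p.hom_embed_int by (auto simp: e_def)
        then show ?thesis
          using gm em w(1) by (simp add: p.S.minus_eq)
      next
        case False
        then show ?thesis
          using gm em w(2) by (simp add: p.S.minus_eq p.S.r_neg)
      qed
    qed
    then have "{m. g m \<noteq> \<zero>\<^bsub>K m\<^esub>} \<subseteq> {m. \<not> avoids_roots (K m) r (x m)}"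
      by blast
    then have "g \<in> N"
      using N(2) gP finite_subset[OF _ x(2)] by (auto simp: J_def simp del: product_ring_simps)
    moreover have "e \<otimes>\<^bsub>?P\<^esub> (f \<otimes>\<^bsub>?P\<^esub> w) \<in> N"
      using f I_l_closed I_r_closed eP wP by (simp only: f_def)
    moreover have "e = g \<oplus>\<^bsub>?P\<^esub> e \<otimes>\<^bsub>?P\<^esub> (f \<otimes>\<^bsub>?P\<^esub> w)"
      unfolding g_def using eP fP wP P.m_closed
      by (simp add: P.minus_eq P.a_assoc P.l_neg del: product_ring_simps)
    ultimately show ?thesis
      using a_closed by (metis e_def)
  qed
  have "power_independent ?Q (range (embed_int ?Q)) (N +>\<^bsub>?P\<^esub> x)"
    unfolding power_independent_def
  proof (intro allI impI)
    fix cs assume "set cs \<subseteq> range (embed_int ?Q)" and z: "horner ?Q (N +>\<^bsub>?P\<^esub> x) cs = \<zero>\<^bsub>?Q\<^esub>"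
    then obtain ds where ds: "cs = map (embed_int ?Q) ds"
      by (metis ex_map_conv subsetD rangeE)
    have "cs = map ((+>\<^bsub>?P\<^esub>) N) (map (embed_int ?P) ds)"
      using h.hom_embed_int by (simp add: ds)
    then have "horner ?P x (map (embed_int ?P) ds) \<in> N"
      using h.hom_horner[OF xP cl] z quotient_zero_iff P.horner_closed[OF xP cl] by metis
    then have "embed_int ?Q d = \<zero>\<^bsub>?Q\<^esub>" if "d \<in> set ds" for d
      using vanish[OF that] h.hom_embed_int quotient_zero_iff P.embed_int_closed by metis
    then show "set cs \<subseteq> {\<zero>\<^bsub>?Q\<^esub>}"
      by (auto simp: ds)
  qed
  then have "has_maximal_subring ?Q"
    using Q.has_maximal_subring_if_power_independent[OF h.S.prime_subring] h.hom_closed xP by blast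
  then show ?thesis
    using has_maximal_subring_if_surjective_hom[OF h.ring_hom_ring_axioms quotient_surj] by blast
qed

theorem has_maximal_subring_product_fields:
  assumes K: "\<And>m::nat. field (K m)"
  shows "has_maximal_subring (product_ring UNIV K)"
proof (cases "\<exists>r. infinite {m. \<nexists>x. x \<in> carrier (K m) \<and> avoids_roots (K m) r x}")
  case True
  then obtain r where inf: "infinite {m. \<nexists>x. x \<in> carrier (K m) \<and> avoids_roots (K m) r x}"
    (is "infinite ?A")
    by blast
  \<comment> \<open>The characteristic. On the infinite set \<open>?A\<close> it is bounded through
    the size of the fields, so it repeats.\<close>
  let ?q = "\<lambda>m. group.ord (add_monoid (K m)) \<one>\<^bsub>K m\<^esub>"
  have small: "finite (carrier (K m))" "card (carrier (K m)) \<le> card (bounded_int_lists r) * r"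
    if "m \<in> ?A" for m
    using domain.card_bound_if_no_avoiding[OF field.axioms(1)[OF K], of m r] that by auto
  have "?q m \<in> {..card (bounded_int_lists r) * r}" if m: "m \<in> ?A" for m
  proof -
    interpret field "K m" by (rule K)
    have "?q m \<le> card (carrier (K m))"
      using add.ord_le_group_order[of "\<one>\<^bsub>K m\<^esub>"] small(1)[OF m] by (simp add: order_def)
    then show ?thesis
      using small(2)[OF m] by simp
  qed
  then have "finite (?q ` ?A)"
    by (intro finite_subset[of "?q ` ?A" "{..card (bounded_int_lists r) * r}"]) auto
  then have "\<not> inj_on ?q ?A"
    using inf finite_imageD by blast
  then obtain i j where ij: "i \<in> ?A" "j \<in> ?A" "i \<noteq> j" "?q i = ?q j"
    unfolding inj_on_def by blast
  show ?thesis
  proof (rule has_maximal_subring_product_finite[OF _ ij(3) small(1)[OF ij(1)] small(1)[OF ij(2)] _ ij(4)])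
    show "ring (K m)" for m
      using K field.is_ring by blast
    show "\<one>\<^bsub>K i\<^esub> \<noteq> \<zero>\<^bsub>K i\<^esub>"
      using fieldE(2)[OF K] by auto
  qed
next
  case False
  define Av where "Av m r \<longleftrightarrow> (\<exists>x. x \<in> carrier (K m) \<and> avoids_roots (K m) r x)" for m r
  have mono: "avoids_roots (K m) r y" if "avoids_roots (K m) r' y" "r \<le> r'" for m r r' y
  proof -
    have "bounded_int_lists r \<subseteq> bounded_int_lists r'"
      using that(2) by (force simp: bounded_int_lists_def)
    then show ?thesis
      using that(1) by (auto simp: avoids_roots_def)
  qed
  \<comment> \<open>The largest stage at which \<open>K m\<close> has an avoiding element, capped by
    m so that the maximum exists; stage 0 contains only the empty list and is always
    attained.\<close>
  define s where "s m = Max {r. r \<le> m \<and> Av m r}" for m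
  have Av0: "Av m 0" for m
  proof -
    interpret field "K m" by (rule K)
    show ?thesis
      unfolding Av_def by (intro exI[of _ "\<zero>\<^bsub>K m\<^esub>"]) (simp add: avoids_roots_def bounded_int_lists_def)
  qed
  have "s m \<in> {r. r \<le> m \<and> Av m r}" for m
    unfolding s_def by (rule Max_in) (use Av0 in auto)
  then have "\<exists>y. y \<in> carrier (K m) \<and> avoids_roots (K m) (s m) y" for m
    by (auto simp: Av_def)
  then obtain x where x: "\<And>m. x m \<in> carrier (K m)" "\<And>m. avoids_roots (K m) (s m) (x m)"
    by metis
  have "finite {m. \<not> avoids_roots (K m) r (x m)}" for r
  proof (rule finite_subset)
    \<comment> \<open>For m at least r, failure of \<open>x m\<close> at stage r means that the
      field has no avoiding element there, which happens for finitely many m only.\<close>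
    show "{m. \<not> avoids_roots (K m) r (x m)} \<subseteq> {..<r} \<union> {m. \<not> Av m r}"
    proof
      fix m assume m: "m \<in> {m. \<not> avoids_roots (K m) r (x m)}"
      have "s m < r"
        using mono[OF x(2)[of m], of r] m by force
      moreover have "r \<le> s m" if "r \<le> m" "Av m r"
        unfolding s_def using that by (intro Max_ge) auto
      ultimately show "m \<in> {..<r} \<union> {m. \<not> Av m r}"
        by force
    qed
    show "finite ({..<r} \<union> {m. \<not> Av m r})"
      using False by (auto simp: Av_def)
  qed
  then show ?thesis
    by (rule has_maximal_subring_product_avoiding[OF K x(1)])
qed

lemma has_maximal_subring_product_ring:
  assumes "infinite I" "\<And>i. i \<in> I \<Longrightarrow> ring (T i)" "\<And>i. i \<in> I \<Longrightarrow> \<one>\<^bsub>T i\<^esub> \<noteq> \<zero>\<^bsub>T i\<^esub>"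
    and "\<And>i. i \<in> I \<Longrightarrow> center_integral (T i)"
  shows "has_maximal_subring (product_ring I T)"
proof (cases "\<exists>i\<in>I. has_maximal_subring (T i)")
  case True
  then show ?thesis
    using has_maximal_subring_if_surjective_hom product_ring_proj product_ring_proj_surj assms(2) by metis
next
  case False
  \<comment> \<open>Restriction to a sequence of distinct indices is a surjection of products, so
    countably many factors suffice.\<close>
  obtain f :: "nat \<Rightarrow> 'a" where f: "inj f" "range f \<subseteq> I"
    using infinite_countable_subset[OF assms(1)] by blast
  then have fI: "f m \<in> I" for m
    by auto
  have "\<exists>M. ideal M (T (f m)) \<and> field (T (f m) Quot M)" for m
    using ring.has_maximal_subring_or_field_quotient[OF assms(2)[OF fI] assms(3)[OF fI] assms(4)[OF fI]]
      False fI by blast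
  then obtain M where M: "\<And>m. ideal (M m) (T (f m))" "\<And>m. field (T (f m) Quot M m)"
    by metis
  let ?h = "\<lambda>m. (+>\<^bsub>T (f m)\<^esub>) (M m)"
  have "has_maximal_subring (product_ring UNIV (\<lambda>m. T (f m) Quot M m))"
    by (rule has_maximal_subring_product_fields) (rule M(2))
  moreover have "ring_hom_ring (product_ring I T) (product_ring UNIV (\<lambda>m. T (f m) Quot M m))
    (\<lambda>x m. ?h m (x (f m)))"
    by (rule product_ring_reindex_hom) (use assms(2) fI ideal.rcos_ring_hom_ring[OF M(1)] in auto)
  moreover have "(\<lambda>x m. ?h m (x (f m))) ` carrier (product_ring I T)
    = carrier (product_ring UNIV (\<lambda>m. T (f m) Quot M m))"
    by (rule product_ring_reindex_surj) (use assms(2) f fI ideal.quotient_surj[OF M(1)] in auto)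
  ultimately show ?thesis
    using has_maximal_subring_if_surjective_hom by blast
qed

theorem theorem4p18:
  fixes I :: "'i set" and T :: "'i \<Rightarrow> ('a, 'b) ring_scheme"
  assumes "infinite I"
    and "\<And>i. i \<in> I \<Longrightarrow> ring (T i)"
    and "\<And>i. i \<in> I \<Longrightarrow> \<one>\<^bsub>T i\<^esub> \<noteq> \<zero>\<^bsub>T i\<^esub>"
  shows "((\<forall>i\<in>I. integral_over_center (T i)) \<longrightarrow> has_maximal_subring (product_ring I T))
     \<and> (integral_over_center (product_ring I T) \<longrightarrow> has_maximal_subring (product_ring I T))"
proof (intro conjI impI)
  assume "\<forall>i\<in>I. integral_over_center (T i)"
  then have int: "center_integral (T i)" if "i \<in> I" for i
    using ring.center_integral_if_integral_over_center[OF assms(2)] that by blast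
  show "has_maximal_subring (product_ring I T)"
    by (rule has_maximal_subring_product_ring) (fact assms int)+
next
  assume "integral_over_center (product_ring I T)"
  moreover have "ring (product_ring I T)"
    by (rule ring_product_ring) (fact assms(2))
  ultimately have int: "center_integral (product_ring I T)"
    using ring.center_integral_if_integral_over_center by blast
  \<comment> \<open>Coordinate projections are surjective, so integrality of the product descends to
    each factor.\<close>
  have int': "center_integral (T i)" if i: "i \<in> I" for i
    by (rule ring_hom_ring.center_integral_surjective_image
        [OF product_ring_proj product_ring_proj_surj int]) (use assms(2) i in auto)
  show "has_maximal_subring (product_ring I T)"
    by (rule has_maximal_subring_product_ring) (fact assms int')+
qed

end
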